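(* Let $D,f_0>0$, $c_*=2\sqrt{Df_0}$, $\alpha>0$, and let $n\in\{1,2,3\}$. Let $$R(t)=c_*t-\alpha\log(t+1)-\eta(t),$$ with $R(t)>0$ for all $t\ge0$, where, as $t\to\infty$, $$\eta(t)=O(1),\quad\dot\eta(t)=o(1/t),\quad\ddot\eta(t)=o(1/t^2),\quad\dddot\eta(t)=o(1/t^3).$$ Let $\psi\ge0$, $\psi\not\equiv0$, satisfy $$\frac{\partial\psi}{\partial t}=D\nabla^2\psi+f_0\psi\ \text{ in }\{|\mathbf{x}|<R(t)\}\subset\mathbb{R}^n,\qquad\psi=0\ \text{ on }|\mathbf{x}|=R(t).$$ Then $$\psi(\mathbf{x},t)=\overline{\underline{O}}\Big(y\,(t+1)^{-1-\frac n2+\frac{\alpha c_*}{2D}}\Big)\quad\text{as } t\to\infty,\ \text{for } y=R(t)-|\mathbf{x}|=O(1);$$ that is, for every $Y>0$ there exist $T>0$ and $0<\beta_0\le\beta_1$ such that for all $t\ge T$ and all $\mathbf{x}$ with $0\le y=R(t)-|\mathbf{x}|\le Y$, $$\beta_0\,y\,(t+1)^{-1-\frac n2+\frac{\alpha c_*}{2D}}\le\psi(\mathbf{x},t)\le\beta_1\,y\,(t+1)^{-1-\frac n2+\frac{\alpha c_*}{2D}}.$$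
   Context: $F_1=\overline{\underline{O}}(F_2)$ ("exactly of the order") means $F_1=O(F_2)$ and $F_2=O(F_1)$ in the limit considered, i.e. there are constants $0<\beta_0\le\beta_1$ with $\beta_0|F_2|\le|F_1|\le\beta_1|F_2|$. The function $\eta$ is assumed sufficiently smooth (three times differentiable, with $R$ twice continuously differentiable). Dots denote derivatives with respect to $t$. *)

theory Defs
  imports "HOL-Analysis.Analysis" "HOL-Library.Landau_Symbols"
begin

text \<open>
  The function \<open>u\<close> has all pure second partial derivatives at \<open>x\<close>, and \<open>L\<close> is their sum.
  Only values of \<open>u\<close> near \<open>x\<close> matter, so \<open>u\<close> may be arbitrary outside a neighbourhood
  of \<open>x\<close>.
\<close>

definition has_laplacian :: "('a::euclidean_space \<Rightarrow> real) \<Rightarrow> real \<Rightarrow> 'a \<Rightarrow> bool" where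
  "has_laplacian u L x \<longleftrightarrow>
    (\<exists>g h. (\<forall>b\<in>Basis.
              (\<forall>\<^sub>F s in nhds (0::real).
                 ((\<lambda>r. u (x + r *\<^sub>R b)) has_real_derivative g b s) (at s)) \<and>
              (g b has_real_derivative h b) (at 0)) \<and>
           L = (\<Sum>b\<in>Basis. h b))"

text \<open>
  Classical solution of \<open>\<psi>\<^sub>t = D \<nabla>\<^sup>2 \<psi> + f0 \<psi>\<close> in the moving ball \<open>norm x < R t\<close>, with zero boundary
  values. Nothing is required at the initial time: any solution that also
  attains initial data at \<open>t = 0\<close>, in whatever sense, is included. Continuity up to the moving
  boundary is what gives the boundary condition its content; continuity of the
  derivatives is not required.
\<close>

definition moving_ball_solution ::
  "real \<Rightarrow> real \<Rightarrow> (real \<Rightarrow> real) \<Rightarrow> ('a::euclidean_space \<Rightarrow> real \<Rightarrow> real) \<Rightarrow> bool" where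
  "moving_ball_solution D f0 R \<psi> \<longleftrightarrow>
     continuous_on {(x, t). 0 < t \<and> norm x \<le> R t} (\<lambda>(x, t). \<psi> x t) \<and>
     (\<forall>t>0. \<forall>x. norm x < R t \<longrightarrow>
        (\<exists>L. has_laplacian (\<lambda>z. \<psi> z t) L x \<and>
             ((\<lambda>s. \<psi> x s) has_real_derivative D * L + f0 * \<psi> x t) (at t))) \<and>
     (\<forall>t>0. \<forall>x. norm x = R t \<longrightarrow> \<psi> x t = 0)"

end

theory Submission
  imports Defs "HOL-Real_Asymp.Real_Asymp"
begin

text \<open>
  Put \<open>\<xi> = x / R t\<close> and write \<open>\<psi> = w * V\<close> with
  \<open>w = R powr (- n / 2) * exp (f0 * t + (G - R * R' / (4 * D)) * \<xi>\<^sup>2)\<close> and \<open>G' = R * R'' / (4 * D)\<close>. All non-integrable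
  terms cancel: \<open>V\<^sub>t = D / R\<^sup>2 * (\<nabla>\<^sup>2 V + 4 * G * \<xi> \<bullet> \<nabla>V + (2 * n * G + 4 * G\<^sup>2 * \<xi>\<^sup>2) * V)\<close> in the fixed unit
  ball, where \<open>G\<close> grows logarithmically, so \<open>G\<^sup>k / R\<^sup>2\<close> is integrable in time for every \<open>k\<close>.
  Hence, with a bounded function \<open>h\<close>, the functions \<open>exp h * (1 - \<xi>\<^sup>2)\<close> and
  \<open>exp (- h) * (m + m powr (3 / 2))\<close>, \<open>m = 1 - \<xi>\<^sup>2\<close>, are a supersolution and a subsolution, and the
  comparison principle shows that \<open>V\<close> is of the exact order \<open>1 - \<xi>\<^sup>2\<close>, that is, \<open>y / (t + 1)\<close>. At distance \<open>O(1)\<close> from the boundary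
  the exponent of \<open>w\<close> is, up to \<open>O(1)\<close>, an antiderivative of
  \<open>f0 - R'\<^sup>2 / (4 * D) = \<alpha> * cs / (2 * D * (t + 1)) + cs * \<eta>' / (2 * D) + O(1 / t\<^sup>2)\<close>, which yields the power of \<open>t + 1\<close>.
\<close>

subsection \<open>The comparison principle\<close>

text \<open>Passing to \<xi> creates a drift with coefficient \<open>R' / R\<close>. The Gaussian
  factor with \<open>R * R' / (4 * D)\<close> removes it, and the power of \<open>R\<close> removes
  the spatially constant zero order term which that factor leaves. There remains the potential
  \<open>R * R'' / (4 * D) * \<xi>^2\<close>, of order \<open>1 / t\<close>: it is not integrable
  and its effect differs from one \<xi> to another, so merely estimating it would lose the exact
  order. The factor \<open>exp (G * \<xi>^2)\<close> removes it exactly; the price is a new drift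
  and new zero order terms, all carrying \<open>D / R^2\<close>. The new drift raises the residual
  of every profile that increases with \<open>m\<close>. This favours the supersolution and works
  against the subsolution, which is why only the latter has the extra term
  \<open>m powr (3 / 2)\<close>. Both barriers vanish linearly on the boundary, whereas at a given
  time nothing is known of \<psi> beyond continuity, sign and boundary values. One unit of time,
  during which the zero of the barrier moves, bridges this gap on either side.\<close>

lemma has_laplacian_diff:
  assumes "has_laplacian u L x" and "has_laplacian v M x"
  shows "has_laplacian (\<lambda>z. u z - v z) (L - M) x"
proof -
  obtain g h where gh: "\<And>b. b \<in> Basis \<Longrightarrow>
      \<forall>\<^sub>F s in nhds (0::real). ((\<lambda>r. u (x + r *\<^sub>R b)) has_real_derivative g b s) (at s)"
      "\<And>b. b \<in> Basis \<Longrightarrow> (g b has_real_derivative h b) (at 0)" "L = (\<Sum>b\<in>Basis. h b)"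
    using assms(1) unfolding has_laplacian_def by blast
  obtain g' h' where gh': "\<And>b. b \<in> Basis \<Longrightarrow>
      \<forall>\<^sub>F s in nhds (0::real). ((\<lambda>r. v (x + r *\<^sub>R b)) has_real_derivative g' b s) (at s)"
      "\<And>b. b \<in> Basis \<Longrightarrow> (g' b has_real_derivative h' b) (at 0)" "M = (\<Sum>b\<in>Basis. h' b)"
    using assms(2) unfolding has_laplacian_def by blast
  show ?thesis
    unfolding has_laplacian_def
  proof (intro exI conjI ballI)
    fix b :: 'a assume b: "b \<in> Basis"
    show "\<forall>\<^sub>F s in nhds 0. ((\<lambda>r. u (x + r *\<^sub>R b) - v (x + r *\<^sub>R b))
        has_real_derivative (\<lambda>b s. g b s - g' b s) b s) (at s)"
      using gh(1)[OF b] gh'(1)[OF b] by eventually_elim (auto intro: derivative_intros)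
    show "((\<lambda>b s. g b s - g' b s) b has_real_derivative (\<lambda>b. h b - h' b) b) (at 0)"
      using gh(2)[OF b] gh'(2)[OF b] by (auto intro: derivative_intros)
  qed (simp add: gh(3) gh'(3) sum_subtractf)
qed

lemma has_laplacian_cmult:
  assumes "has_laplacian u L x"
  shows "has_laplacian (\<lambda>z. c * u z) (c * L) x"
proof -
  obtain g h where gh: "\<And>b. b \<in> Basis \<Longrightarrow>
      \<forall>\<^sub>F s in nhds (0::real). ((\<lambda>r. u (x + r *\<^sub>R b)) has_real_derivative g b s) (at s)"
      "\<And>b. b \<in> Basis \<Longrightarrow> (g b has_real_derivative h b) (at 0)" "L = (\<Sum>b\<in>Basis. h b)"
    using assms unfolding has_laplacian_def by blast
  show ?thesis
    unfolding has_laplacian_def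
  proof (intro exI conjI ballI)
    fix b :: 'a assume b: "b \<in> Basis"
    show "\<forall>\<^sub>F s in nhds 0. ((\<lambda>r. c * u (x + r *\<^sub>R b))
        has_real_derivative (\<lambda>b s. c * g b s) b s) (at s)"
      using gh(1)[OF b] by eventually_elim (auto intro: DERIV_cmult)
    show "((\<lambda>b s. c * g b s) b has_real_derivative (\<lambda>b. c * h b) b) (at 0)"
      using gh(2)[OF b] by (auto intro: DERIV_cmult)
  qed (simp add: gh(3) sum_distrib_left)
qed

text \<open>Along a coordinate line the squared norm is a quadratic polynomial. Taking
  \<open>F\<close> as a function of it therefore avoids any singularity at the centre, and the chain
  rule applies line by line.\<close>

lemma has_laplacian_radial:
  fixes x c :: "'a::euclidean_space" and F F1 :: "real \<Rightarrow> real"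
  assumes F: "\<forall>\<^sub>F q in nhds ((norm (x - c))\<^sup>2). (F has_real_derivative F1 q) (at q)"
    and F1: "(F1 has_real_derivative F2) (at ((norm (x - c))\<^sup>2))"
  shows "has_laplacian (\<lambda>z. F ((norm (z - c))\<^sup>2))
           (2 * DIM('a) * F1 ((norm (x - c))\<^sup>2) + 4 * (norm (x - c))\<^sup>2 * F2) x"
proof -
  define y where "y = x - c"
  define q where "q b s = (norm y)\<^sup>2 + 2 * s * (y \<bullet> b) + s\<^sup>2" for b s
  have q: "(norm (x + s *\<^sub>R b - c))\<^sup>2 = q b s" if "b \<in> Basis" for b s
  proof -
    have "x + s *\<^sub>R b - c = y + s *\<^sub>R b" by (simp add: y_def)
    moreover have "b \<bullet> b = 1" using that by (simp add: inner_Basis)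
    ultimately show ?thesis
      unfolding power2_norm_eq_inner q_def
      by (simp add: inner_add_left inner_add_right inner_commute power2_eq_square algebra_simps)
  qed
  have q0: "q b 0 = (norm y)\<^sup>2" for b by (simp add: q_def)
  have dq: "(q b has_real_derivative 2 * (y \<bullet> b) + 2 * s) (at s)" for b s
    unfolding q_def by (auto intro!: derivative_eq_intros)
  show ?thesis
    unfolding has_laplacian_def
  proof (intro exI conjI ballI)
    fix b :: 'a assume b: "b \<in> Basis"
    have "isCont (q b) 0" using dq DERIV_isCont by blast
    then have "filterlim (q b) (nhds (q b 0)) (nhds 0)"
      by (metis continuous_at tendsto_nhds_iff)
    then have "\<forall>\<^sub>F s in nhds 0. (F has_real_derivative F1 (q b s)) (at (q b s))"
      using F unfolding q0 y_def[symmetric] by (rule eventually_compose_filterlim[rotated])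
    then show "\<forall>\<^sub>F s in nhds 0. ((\<lambda>r. F ((norm (x + r *\<^sub>R b - c))\<^sup>2))
        has_real_derivative (\<lambda>b s. F1 (q b s) * (2 * (y \<bullet> b) + 2 * s)) b s) (at s)"
      unfolding q[OF b] by eventually_elim (rule DERIV_chain2[OF _ dq])
    have "((\<lambda>s. F1 (q b s)) has_real_derivative F2 * (2 * (y \<bullet> b) + 2 * 0)) (at 0)"
      using F1 unfolding y_def[symmetric] by (intro DERIV_chain2[OF _ dq]) (simp add: q0)
    then show "((\<lambda>b s. F1 (q b s) * (2 * (y \<bullet> b) + 2 * s)) b has_real_derivative
        (\<lambda>b. 4 * F2 * (y \<bullet> b)\<^sup>2 + 2 * F1 ((norm y)\<^sup>2)) b) (at 0)"
      by (auto intro!: derivative_eq_intros simp: q0 power2_eq_square)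
  next
    have "(\<Sum>b\<in>Basis. (y \<bullet> b)\<^sup>2) = (norm y)\<^sup>2"
      by (subst power2_norm_eq_inner, subst euclidean_inner) (simp add: power2_eq_square)
    then show "2 * DIM('a) * F1 ((norm (x - c))\<^sup>2) + 4 * (norm (x - c))\<^sup>2 * F2 =
        (\<Sum>b\<in>Basis. 4 * F2 * (y \<bullet> b)\<^sup>2 + 2 * F1 ((norm y)\<^sup>2))"
      by (simp add: sum.distrib sum_distrib_left[symmetric] y_def)
  qed
qed

text \<open>If \<open>h > 0\<close>, then \<open>g\<close> is positive just to the right of its zero
  at \<open>0\<close>, and the mean value theorem makes \<open>f\<close> exceed its maximum there.
  Differentiability of \<open>g\<close> at the single point \<open>0\<close> is enough for
  this.\<close>

lemma second_derivative_nonpos_at_max: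
  fixes f :: "real \<Rightarrow> real"
  assumes f: "\<forall>\<^sub>F s in nhds 0. (f has_real_derivative g s) (at s)"
    and g: "(g has_real_derivative h) (at 0)"
    and max: "\<forall>\<^sub>F s in nhds 0. f s \<le> f 0"
  shows "h \<le> 0"
proof (rule ccontr)
  assume "\<not> h \<le> 0"
  obtain e where e: "e > 0" "\<And>s. \<bar>s\<bar> < e \<Longrightarrow> (f has_real_derivative g s) (at s)"
      "\<And>s. \<bar>s\<bar> < e \<Longrightarrow> f s \<le> f 0"
    using eventually_conj[OF f max] unfolding eventually_nhds_metric dist_real_def by auto
  have "g 0 = 0"
    using e by (intro DERIV_local_max[OF e(2) e(1)]) auto
  moreover obtain d where d: "d > 0" "\<And>s. 0 < s \<Longrightarrow> s < d \<Longrightarrow> g 0 < g (0 + s)"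
    using DERIV_pos_inc_right[OF g] \<open>\<not> h \<le> 0\<close> by auto
  ultimately have pos: "g s > 0" if "0 < s" "s < d" for s using that by force
  define r where "r = min d e / 2"
  have r: "0 < r" "r < d" "r < e" using d(1) e(1) by (auto simp: r_def)
  obtain s where s: "0 < s" "s < r" "f r - f 0 = (r - 0) * g s"
    using MVT2[OF r(1), of f g] e(2) r by force
  have "0 < r * g s" using pos[of s] s r by simp
  then show False using s(3) e(3)[of r] r by simp
qed

lemma has_laplacian_nonpos_at_max:
  assumes "has_laplacian u L x" and "\<forall>\<^sub>F y in nhds x. u y \<le> u x"
  shows "L \<le> 0"
proof -
  obtain g h where gh: "\<And>b. b \<in> Basis \<Longrightarrow>
      \<forall>\<^sub>F s in nhds (0::real). ((\<lambda>r. u (x + r *\<^sub>R b)) has_real_derivative g b s) (at s)"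
      "\<And>b. b \<in> Basis \<Longrightarrow> (g b has_real_derivative h b) (at 0)" "L = (\<Sum>b\<in>Basis. h b)"
    using assms(1) unfolding has_laplacian_def by blast
  have "h b \<le> 0" if b: "b \<in> Basis" for b
  proof (rule second_derivative_nonpos_at_max[OF gh(1,2)[OF b]])
    have "((\<lambda>s. x + s *\<^sub>R b) \<longlongrightarrow> x + 0 *\<^sub>R b) (nhds 0)"
      by (intro tendsto_intros filterlim_ident)
    then show "\<forall>\<^sub>F s in nhds 0. u (x + s *\<^sub>R b) \<le> u (x + 0 *\<^sub>R b)"
      using assms(2) by (auto intro: eventually_compose_filterlim)
  qed
  then show ?thesis using gh(3) by (simp add: sum_nonpos)
qed

text \<open>The factor \<open>exp (- (f + 1) * t)\<close> makes the zeroth order term strictly dissipative, so a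
  positive maximum is impossible.\<close>

lemma parabolic_maximum_principle:
  fixes u :: "'a::euclidean_space \<Rightarrow> real \<Rightarrow> real"
  assumes K: "compact K" and cont: "continuous_on K (\<lambda>(x, t). u x t)" and "D > 0"
    and int: "\<And>x t. (x, t) \<in> K \<Longrightarrow> u x t > 0 \<Longrightarrow>
      (\<forall>\<^sub>F y in nhds x. (y, t) \<in> K) \<and> (\<forall>\<^sub>F s in at_left t. (x, s) \<in> K) \<and>
      (\<exists>L d. has_laplacian (\<lambda>z. u z t) L x \<and> ((\<lambda>s. u x s) has_real_derivative d) (at t) \<and>
             d \<le> D * L + f * u x t)"
    and "(x0, t0) \<in> K"
  shows "u x0 t0 \<le> 0"
proof (rule ccontr)
  assume neg: "\<not> u x0 t0 \<le> 0"
  define v where "v x t = exp (- (f + 1) * t) * u x t" for x t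
  have "continuous_on K (\<lambda>z. exp (- (f + 1) * snd z) * (\<lambda>(x, t). u x t) z)"
    by (intro continuous_intros cont)
  then have "continuous_on K (\<lambda>(x, t). v x t)"
    by (simp add: v_def case_prod_unfold)
  then obtain z where z: "z \<in> K" "\<And>z'. z' \<in> K \<Longrightarrow> (\<lambda>(x, t). v x t) z' \<le> (\<lambda>(x, t). v x t) z"
    using continuous_attains_sup[OF K] assms(5) by (metis empty_iff)
  obtain x t where xt: "z = (x, t)" by force
  have max: "v y s \<le> v x t" if "(y, s) \<in> K" for y s
    using z(2)[OF that] xt by simp
  have "0 < v x0 t0" using neg by (simp add: v_def)
  then have "0 < v x t" using max[OF assms(5)] by linarith
  then have u: "u x t > 0" by (simp add: v_def zero_less_mult_iff)
  obtain L d where Ld: "has_laplacian (\<lambda>z. u z t) L x"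
      "((\<lambda>s. u x s) has_real_derivative d) (at t)" "d \<le> D * L + f * u x t"
    and ev: "\<forall>\<^sub>F y in nhds x. (y, t) \<in> K" "\<forall>\<^sub>F s in at_left t. (x, s) \<in> K"
    using int[OF _ u] z(1) xt by blast
  have "\<forall>\<^sub>F y in nhds x. u y t \<le> u x t"
    using ev(1) by eventually_elim (use max in \<open>force simp: v_def\<close>)
  then have "L \<le> 0" by (rule has_laplacian_nonpos_at_max[OF Ld(1)])
  then have "d \<le> f * u x t" using Ld(3) \<open>D > 0\<close> mult_nonneg_nonpos[of D L] by linarith
  then have "d - (f + 1) * u x t < 0" using u by (simp add: algebra_simps)
  then have neg: "exp (- (f + 1) * t) * (d - (f + 1) * u x t) < 0"
    by (simp add: mult_pos_neg)
  have "((\<lambda>s. v x s) has_real_derivative exp (- (f + 1) * t) * (d - (f + 1) * u x t)) (at t)"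
    unfolding v_def using Ld(2) by (auto intro!: derivative_eq_intros simp: algebra_simps)
  \<comment> \<open>A negative time derivative makes \<open>v\<close> larger at slightly earlier
    times. Only such times are used, so a maximum at the final time needs no separate
    treatment.\<close>
  from DERIV_neg_dec_left[OF this neg] obtain e where
    e: "e > 0" "\<And>h. 0 < h \<Longrightarrow> h < e \<Longrightarrow> v x t < v x (t - h)" by blast
  have "\<forall>\<^sub>F s in at_left t. s \<in> {t - e<..<t}"
    using e(1) by (auto intro: eventually_at_leftI[of "t - e"])
  then have "\<forall>\<^sub>F s in at_left t. v x t < v x s \<and> v x s \<le> v x t"
    using ev(2)
  proof eventually_elim
    case (elim s)
    then show ?case using e(2)[of "t - s"] max by auto
  qed
  then have "\<forall>\<^sub>F s in at_left t. False" by eventually_elim auto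
  then show False by simp
qed

lemma compact_tube:
  fixes c :: "real \<Rightarrow> 'a::euclidean_space" and r :: "real \<Rightarrow> real"
  assumes c: "continuous_on {t0..t1} c" and r: "continuous_on {t0..t1} r"
  shows "compact {(x, t). t0 \<le> t \<and> t \<le> t1 \<and> norm (x - c t) \<le> r t}" (is "compact ?K")
proof -
  have snd: "continuous_on (UNIV \<times> {t0..t1}) (\<lambda>z::'a \<times> real. f (snd z))"
    if "continuous_on {t0..t1} f" for f :: "real \<Rightarrow> 'b::topological_space"
    by (rule continuous_on_compose2[OF that]) (auto intro: continuous_intros)
  have eq: "?K = {z \<in> UNIV \<times> {t0..t1}. norm (fst z - c (snd z)) \<le> r (snd z)}" by auto
  have "closed ?K"
    unfolding eq
    by (intro continuous_on_closed_Collect_le continuous_intros snd[OF c] snd[OF r] closed_Times)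
  moreover have "bounded ?K"
  proof -
    have "bounded (c ` {t0..t1})" "bounded (r ` {t0..t1})"
      using c r by (auto intro: compact_imp_bounded compact_continuous_image)
    then obtain A B where AB: "\<And>t. t \<in> {t0..t1} \<Longrightarrow> norm (c t) \<le> A"
        "\<And>t. t \<in> {t0..t1} \<Longrightarrow> norm (r t) \<le> B"
      unfolding bounded_iff by blast
    have "?K \<subseteq> cball 0 (A + B) \<times> {t0..t1}"
    proof clarify
      fix x t assume xt: "t0 \<le> t" "t \<le> t1" "norm (x - c t) \<le> r t"
      have "norm x \<le> norm (x - c t) + norm (c t)"
        by (metis add.commute norm_triangle_sub)
      then have "norm x \<le> A + B" using AB[of t] xt by auto
      then show "x \<in> cball 0 (A + B) \<and> t \<in> {t0..t1}" using xt by simp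
    qed
    then show ?thesis by (rule bounded_subset[rotated]) (auto intro: bounded_Times)
  qed
  ultimately show ?thesis by (simp add: compact_eq_bounded_closed)
qed

text \<open>A point with \<open>u x t > 0\<close> lies neither on the initial slice nor on the
  lateral surface, so it has room in space and backwards in time, which is all that the maximum
  principle asks. The centre may move because positivity will be carried along a segment.\<close>

lemma tube_comparison:
  fixes u :: "'a::euclidean_space \<Rightarrow> real \<Rightarrow> real"
  assumes "D > 0" and c: "continuous_on {t0..t1} c" and r: "continuous_on {t0..t1} r"
    and cont: "continuous_on {(x, t). t0 \<le> t \<and> t \<le> t1 \<and> norm (x - c t) \<le> r t} (\<lambda>(x, t). u x t)"
    and init: "\<And>x. norm (x - c t0) \<le> r t0 \<Longrightarrow> u x t0 \<le> 0"
    and lateral: "\<And>x t. t0 \<le> t \<Longrightarrow> t \<le> t1 \<Longrightarrow> norm (x - c t) = r t \<Longrightarrow> u x t \<le> 0"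
    and int: "\<And>x t. t0 < t \<Longrightarrow> t \<le> t1 \<Longrightarrow> norm (x - c t) < r t \<Longrightarrow>
      \<exists>L d. has_laplacian (\<lambda>z. u z t) L x \<and> ((\<lambda>s. u x s) has_real_derivative d) (at t) \<and>
             d \<le> D * L + f * u x t"
    and "t0 \<le> t" "t \<le> t1" "norm (x - c t) \<le> r t"
  shows "u x t \<le> 0"
proof (rule parabolic_maximum_principle[OF compact_tube[OF c r] cont \<open>D > 0\<close>])
  show "(x, t) \<in> {(x, t). t0 \<le> t \<and> t \<le> t1 \<and> norm (x - c t) \<le> r t}" using assms by simp
next
  fix x t
  assume "(x, t) \<in> {(x, t). t0 \<le> t \<and> t \<le> t1 \<and> norm (x - c t) \<le> r t}" and u: "0 < u x t"
  then have le: "t0 \<le> t" "t \<le> t1" "norm (x - c t) \<le> r t" by auto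
  have "t \<noteq> t0" using init[of x] le u by auto
  moreover have "norm (x - c t) \<noteq> r t" using lateral[OF le(1,2)] u by force
  ultimately have xt: "t0 < t" "t \<le> t1" "norm (x - c t) < r t" using le by auto
  have "continuous_on {t0..t} (\<lambda>s. r s - norm (x - c s))"
    by (intro continuous_intros continuous_on_subset[OF c] continuous_on_subset[OF r])
       (use xt in auto)
  then have "((\<lambda>s. r s - norm (x - c s)) \<longlongrightarrow> r t - norm (x - c t)) (at t within {t0..t})"
    unfolding continuous_on_def by (rule bspec) (use xt(1) in simp)
  then have "((\<lambda>s. r s - norm (x - c s)) \<longlongrightarrow> r t - norm (x - c t)) (at_left t)"
    unfolding at_within_Icc_at_left[OF xt(1)] .
  then have "\<forall>\<^sub>F s in at_left t. r s - norm (x - c s) > 0"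
    by (rule order_tendstoD(1)) (use xt in simp)
  moreover have "\<forall>\<^sub>F s in at_left t. s \<in> {t0<..<t}"
    using xt by (auto intro: eventually_at_leftI[of t0])
  ultimately have left: "\<forall>\<^sub>F s in at_left t.
      (x, s) \<in> {(x, t). t0 \<le> t \<and> t \<le> t1 \<and> norm (x - c t) \<le> r t}"
    by eventually_elim (use xt in auto)
  have "((\<lambda>y. norm (y - c t)) \<longlongrightarrow> norm (x - c t)) (nhds x)"
    by (intro tendsto_intros filterlim_ident)
  then have "\<forall>\<^sub>F y in nhds x. norm (y - c t) < r t"
    by (rule order_tendstoD(2)) (use xt in simp)
  then have near: "\<forall>\<^sub>F y in nhds x. (y, t) \<in> {(x, t). t0 \<le> t \<and> t \<le> t1 \<and> norm (x - c t) \<le> r t}"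
    by eventually_elim (use xt in auto)
  show "(\<forall>\<^sub>F y in nhds x. (y, t) \<in> {(x, t). t0 \<le> t \<and> t \<le> t1 \<and> norm (x - c t) \<le> r t}) \<and>
      (\<forall>\<^sub>F s in at_left t. (x, s) \<in> {(x, t). t0 \<le> t \<and> t \<le> t1 \<and> norm (x - c t) \<le> r t}) \<and>
      (\<exists>L d. has_laplacian (\<lambda>z. u z t) L x \<and> ((\<lambda>s. u x s) has_real_derivative d) (at t) \<and>
             d \<le> D * L + f * u x t)"
    using left near int[OF xt] by blast
qed

text \<open>The defect of \<open>w\<close> in the equation: zero for a solution, nonnegative for a
  supersolution, nonpositive for a subsolution. A relation is used because the Laplacian and the
  time derivative are given by existence.\<close>

definition has_residual ::
  "real \<Rightarrow> real \<Rightarrow> ('a::euclidean_space \<Rightarrow> real \<Rightarrow> real) \<Rightarrow> 'a \<Rightarrow> real \<Rightarrow> real \<Rightarrow> bool" where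
  "has_residual D f0 w x t \<rho> \<longleftrightarrow>
     (\<exists>L d. has_laplacian (\<lambda>z. w z t) L x \<and> ((\<lambda>s. w x s) has_real_derivative d) (at t) \<and>
            \<rho> = d - D * L - f0 * w x t)"

lemma has_residual_diff:
  assumes "has_residual D f0 v x t \<rho>" and "has_residual D f0 w x t \<rho>'"
  shows "has_residual D f0 (\<lambda>x t. v x t - w x t) x t (\<rho> - \<rho>')"
proof -
  obtain L d where v: "has_laplacian (\<lambda>z. v z t) L x" "((\<lambda>s. v x s) has_real_derivative d) (at t)"
      "\<rho> = d - D * L - f0 * v x t"
    using assms(1) unfolding has_residual_def by blast
  obtain L' d' where w: "has_laplacian (\<lambda>z. w z t) L' x"
      "((\<lambda>s. w x s) has_real_derivative d') (at t)" "\<rho>' = d' - D * L' - f0 * w x t"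
    using assms(2) unfolding has_residual_def by blast
  show ?thesis
    unfolding has_residual_def
    by (intro exI conjI, rule has_laplacian_diff[OF v(1) w(1)], rule DERIV_diff[OF v(2) w(2)])
       (simp add: v(3) w(3) algebra_simps)
qed

lemma has_residual_cmult:
  assumes "has_residual D f0 v x t \<rho>"
  shows "has_residual D f0 (\<lambda>x t. k * v x t) x t (k * \<rho>)"
proof -
  obtain L d where v: "has_laplacian (\<lambda>z. v z t) L x" "((\<lambda>s. v x s) has_real_derivative d) (at t)"
      "\<rho> = d - D * L - f0 * v x t"
    using assms(1) unfolding has_residual_def by blast
  show ?thesis
    unfolding has_residual_def
    by (intro exI conjI, rule has_laplacian_cmult[OF v(1)], rule DERIV_cmult[OF v(2)])
       (simp add: v(3) algebra_simps)
qed

lemma tube_comparison_residual: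
  fixes v w :: "'a::euclidean_space \<Rightarrow> real \<Rightarrow> real"
  assumes "D > 0" and c: "continuous_on {t0..t1} c" and r: "continuous_on {t0..t1} r"
    and v: "continuous_on {(x, t). t0 \<le> t \<and> t \<le> t1 \<and> norm (x - c t) \<le> r t} (\<lambda>(x, t). v x t)"
    and w: "continuous_on {(x, t). t0 \<le> t \<and> t \<le> t1 \<and> norm (x - c t) \<le> r t} (\<lambda>(x, t). w x t)"
    and init: "\<And>x. norm (x - c t0) \<le> r t0 \<Longrightarrow> v x t0 \<le> w x t0"
    and lateral: "\<And>x t. t0 \<le> t \<Longrightarrow> t \<le> t1 \<Longrightarrow> norm (x - c t) = r t \<Longrightarrow> v x t \<le> w x t"
    and int: "\<And>x t. t0 < t \<Longrightarrow> t \<le> t1 \<Longrightarrow> norm (x - c t) < r t \<Longrightarrow>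
      \<exists>\<rho> \<rho>'. has_residual D f0 v x t \<rho> \<and> has_residual D f0 w x t \<rho>' \<and> \<rho> \<le> \<rho>'"
    and "t0 \<le> t" "t \<le> t1" "norm (x - c t) \<le> r t"
  shows "v x t \<le> w x t"
proof -
  have "(\<lambda>x t. v x t - w x t) x t \<le> 0"
  proof (rule tube_comparison[where u = "\<lambda>x t. v x t - w x t" and f = f0, OF \<open>D > 0\<close> c r])
    show "continuous_on {(x, t). t0 \<le> t \<and> t \<le> t1 \<and> norm (x - c t) \<le> r t}
        (\<lambda>(x, t). v x t - w x t)"
      using continuous_on_diff[OF v w] by (simp add: case_prod_unfold)
    fix x t assume "t0 < t" "t \<le> t1" "norm (x - c t) < r t"
    from int[OF this] obtain \<rho> \<rho>' where "has_residual D f0 v x t \<rho>" "has_residual D f0 w x t \<rho>'"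
        "\<rho> \<le> \<rho>'" by blast
    from has_residual_diff[OF this(1,2)] this(3)
    show "\<exists>L d. has_laplacian (\<lambda>z. v z t - w z t) L x \<and>
        ((\<lambda>s. v x s - w x s) has_real_derivative d) (at t) \<and> d \<le> D * L + f0 * (v x t - w x t)"
      unfolding has_residual_def by fastforce
  qed (use assms in auto)
  then show ?thesis by simp
qed

lemma moving_ball_solution_residual:
  assumes "moving_ball_solution D f0 R \<psi>" "t > 0" "norm x < R t"
  shows "has_residual D f0 \<psi> x t 0"
proof -
  obtain L where "has_laplacian (\<lambda>z. \<psi> z t) L x"
      "((\<lambda>s. \<psi> x s) has_real_derivative D * L + f0 * \<psi> x t) (at t)"
    using assms unfolding moving_ball_solution_def by blast
  then show ?thesis unfolding has_residual_def by (intro exI conjI) auto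
qed

subsection \<open>Barriers\<close>

text \<open>The factor \<open>w\<close> in the variable \<open>x\<close>. The power of
  \<open>R\<close> enters as a logarithm, so that differentiation meets a single
  exponential.\<close>

definition barrier_weight ::
  "real \<Rightarrow> real \<Rightarrow> (real \<Rightarrow> real) \<Rightarrow> (real \<Rightarrow> real) \<Rightarrow> (real \<Rightarrow> real) \<Rightarrow> 'a::euclidean_space \<Rightarrow> real \<Rightarrow> real"
  where "barrier_weight D f0 R R1 G x t =
    exp (f0 * t - real DIM('a) / 2 * ln (R t) + (G t / (R t)\<^sup>2 - R1 t / (4 * D * R t)) * (norm x)\<^sup>2)"

text \<open>The zero of the profile is movable: \<open>\<sigma> t = 1\<close> puts it on
  \<open>norm x = R t\<close>, other values serve an initial unit of time. The factor
  \<open>exp (- h t)\<close> is there to absorb the error terms.\<close>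

definition barrier ::
  "real \<Rightarrow> real \<Rightarrow> (real \<Rightarrow> real) \<Rightarrow> (real \<Rightarrow> real) \<Rightarrow> (real \<Rightarrow> real) \<Rightarrow> (real \<Rightarrow> real) \<Rightarrow> (real \<Rightarrow> real) \<Rightarrow>
     (real \<Rightarrow> real) \<Rightarrow> 'a::euclidean_space \<Rightarrow> real \<Rightarrow> real"
  where "barrier D f0 R R1 G h \<sigma> \<phi> x t =
    barrier_weight D f0 R R1 G x t * (exp (- h t) * \<phi> (\<sigma> t - (norm x / R t)\<^sup>2))"

text \<open>Once the weight is divided out, every coefficient except \<open>h1\<close> and
  \<open>\<sigma>1\<close> carries \<open>D / (R t)^2\<close>. The cancellations behind this are
  \<open>c1\<close> for the terms in \<open>q * \<phi> m\<close>, \<open>c2\<close> for the drift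
  and \<open>c3\<close> for the spatially constant zero order term.\<close>

lemma barrier_residual:
  fixes x :: "'a::euclidean_space"
  defines "n \<equiv> real DIM('a)"
  assumes "D > 0" and Rpos: "R t > 0"
    and R: "(R has_real_derivative R1 t) (at t)" and R1: "(R1 has_real_derivative R2) (at t)"
    and G: "(G has_real_derivative R t * R2 / (4 * D)) (at t)"
    and h: "(h has_real_derivative h1) (at t)" and \<sigma>: "(\<sigma> has_real_derivative \<sigma>1) (at t)"
    and \<zeta>: "\<zeta> = (norm x / R t)\<^sup>2" and m: "m = \<sigma> t - \<zeta>"
    and \<phi>: "\<forall>\<^sub>F p in nhds m. (\<phi> has_real_derivative \<phi>1 p) (at p)"
    and \<phi>1: "(\<phi>1 has_real_derivative \<phi>2) (at m)"
  shows "has_residual D f0 (barrier D f0 R R1 G h \<sigma> \<phi>) x t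
    (barrier_weight D f0 R R1 G x t * exp (- h t) *
      (\<phi> m * (- h1 - D / (R t)\<^sup>2 * (2 * n * G t + 4 * \<zeta> * (G t)\<^sup>2)) +
       \<phi>1 m * (\<sigma>1 + D / (R t)\<^sup>2 * (2 * n + 8 * \<zeta> * G t)) - D / (R t)\<^sup>2 * 4 * \<zeta> * \<phi>2))"
proof -
  define q where "q = (norm x)\<^sup>2"
  define g where "g = G t / (R t)\<^sup>2 - R1 t / (4 * D * R t)"
  \<comment> \<open>The first term is the derivative of \<open>G\<close> over
    \<open>(R t)^2\<close>. By the choice of that derivative it cancels the third, so
    \<open>R2\<close> disappears.\<close>
  define g' where "g' = R2 / (4 * D * R t) - 2 * G t * R1 t / (R t)^3 - R2 / (4 * D * R t) +
    (R1 t)\<^sup>2 / (4 * D * (R t)\<^sup>2)"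
  define e where "e p = exp (f0 * t - n / 2 * ln (R t) + g * p) * exp (- h t)" for p
  define P where "P p = \<sigma> t - p / (R t)\<^sup>2" for p
  have Pq: "P q = m" using Rpos by (simp add: P_def m \<zeta> q_def power_divide)
  have e: "(e has_real_derivative e p * g) (at p)" for p
    unfolding e_def by (auto intro!: derivative_eq_intros)
  have P: "(P has_real_derivative - 1 / (R t)\<^sup>2) (at p)" for p
    unfolding P_def using Rpos by (auto intro!: derivative_eq_intros simp: field_simps)
  define F1 where "F1 p = e p * (g * \<phi> (P p) - \<phi>1 (P p) / (R t)\<^sup>2)" for p
  have eqw: "barrier D f0 R R1 G h \<sigma> \<phi> z t = (\<lambda>p. e p * \<phi> (P p)) ((norm (z - 0))\<^sup>2)" for z :: 'a
    by (simp add: barrier_def barrier_weight_def e_def P_def g_def n_def power_divide)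
  have "filterlim P (nhds m) (nhds q)"
    using DERIV_isCont[OF P[of q]] Pq by (metis continuous_at tendsto_nhds_iff)
  then have "\<forall>\<^sub>F p in nhds q. (\<phi> has_real_derivative \<phi>1 (P p)) (at (P p))"
    using \<phi> by (rule eventually_compose_filterlim[rotated])
  then have ev: "\<forall>\<^sub>F p in nhds q. ((\<lambda>p. e p * \<phi> (P p)) has_real_derivative F1 p) (at p)"
  proof eventually_elim
    case (elim p)
    have "((\<lambda>p. \<phi> (P p)) has_real_derivative \<phi>1 (P p) * (- 1 / (R t)\<^sup>2)) (at p)"
      by (rule DERIV_chain2[OF elim P])
    from DERIV_mult[OF e this] show ?case by (simp add: F1_def algebra_simps)
  qed
  have \<phi>m: "(\<phi> has_real_derivative \<phi>1 m) (at m)" using \<phi> by (rule eventually_nhds_x_imp_x)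
  have "((\<lambda>p. \<phi> (P p)) has_real_derivative \<phi>1 m * (- 1 / (R t)\<^sup>2)) (at q)"
    using DERIV_chain2[OF _ P, of \<phi> _ q] \<phi>m Pq by simp
  moreover have "((\<lambda>p. \<phi>1 (P p)) has_real_derivative \<phi>2 * (- 1 / (R t)\<^sup>2)) (at q)"
    using DERIV_chain2[OF _ P, of \<phi>1 _ q] \<phi>1 Pq by simp
  ultimately have "(F1 has_real_derivative
      e q * g * (g * \<phi> m - \<phi>1 m / (R t)\<^sup>2) +
      e q * (g * (\<phi>1 m * (- 1 / (R t)\<^sup>2)) - \<phi>2 * (- 1 / (R t)\<^sup>2) / (R t)\<^sup>2)) (at q)"
    unfolding F1_def using e[of q] Rpos Pq by (auto intro!: derivative_eq_intros)
  from has_laplacian_radial[where x = x and c = 0 and F = "\<lambda>p. e p * \<phi> (P p)" ] ev this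
  have lap: "has_laplacian (\<lambda>z. barrier D f0 R R1 G h \<sigma> \<phi> z t)
     (2 * n * F1 q + 4 * q * (e q * g * (g * \<phi> m - \<phi>1 m / (R t)\<^sup>2) +
      e q * (g * (\<phi>1 m * (- 1 / (R t)\<^sup>2)) - \<phi>2 * (- 1 / (R t)\<^sup>2) / (R t)\<^sup>2))) x"
    unfolding eqw n_def q_def by simp
  define gs where "gs s = G s / (R s)\<^sup>2 - R1 s / (4 * D * R s)" for s
  have gt: "(gs has_real_derivative g') (at t)"
    unfolding g'_def gs_def using Rpos \<open>D > 0\<close>
    by (auto intro!: derivative_eq_intros G R R1 simp: field_simps power2_eq_square power3_eq_cube)
  have Pt: "((\<lambda>s. \<sigma> s - (norm x / R s)\<^sup>2) has_real_derivative \<sigma>1 + 2 * q * R1 t / (R t)^3) (at t)"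
    unfolding q_def using Rpos
    by (auto intro!: derivative_eq_intros \<sigma> R simp: field_simps power2_eq_square power3_eq_cube)
  have \<phi>t: "((\<lambda>s. \<phi> (\<sigma> s - (norm x / R s)\<^sup>2)) has_real_derivative
      \<phi>1 m * (\<sigma>1 + 2 * q * R1 t / (R t)^3)) (at t)"
    using DERIV_chain2[OF _ Pt, of \<phi>] \<phi>m m \<zeta> by simp
  have at: "((\<lambda>s. f0 * s - n / 2 * ln (R s) + gs s * (norm x)\<^sup>2) has_real_derivative
      f0 - n / 2 * (R1 t / R t) + g' * q) (at t)"
    unfolding q_def using Rpos
    by (auto intro!: derivative_eq_intros gt R)
  have et: "exp (f0 * t - n / 2 * ln (R t) + gs t * (norm x)\<^sup>2) * exp (- h t) = e q"
    by (simp add: e_def g_def gs_def q_def)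
  have time: "((\<lambda>s. barrier D f0 R R1 G h \<sigma> \<phi> x s) has_real_derivative
      e q * (f0 - n / 2 * (R1 t / R t) + g' * q - h1) * \<phi> m +
      e q * (\<phi>1 m * (\<sigma>1 + 2 * q * R1 t / (R t)^3))) (at t)"
    unfolding barrier_def barrier_weight_def n_def[symmetric] gs_def[symmetric]
    by (rule DERIV_cong, (rule derivative_intros DERIV_chain2[OF DERIV_exp] at h \<phi>t)+)
       (simp add: et[symmetric] m \<zeta> algebra_simps)
  have c1: "g' = 4 * D * g\<^sup>2 - 4 * D * (G t)\<^sup>2 / (R t)^4"
    unfolding g'_def g_def using Rpos \<open>D > 0\<close>
    by (simp add: field_simps power2_eq_square power3_eq_cube power4_eq_xxxx)
  have c2: "2 * q * R1 t / (R t)^3 + 8 * D * q * g / (R t)\<^sup>2 = 8 * D * q * G t / (R t)^4"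
    unfolding g_def using Rpos \<open>D > 0\<close>
    by (simp add: field_simps power2_eq_square power3_eq_cube power4_eq_xxxx)
  have c3: "n / 2 * (R1 t / R t) + 2 * D * n * g = 2 * D * n * G t / (R t)\<^sup>2"
    unfolding g_def using Rpos \<open>D > 0\<close>
    by (simp add: field_simps power2_eq_square power3_eq_cube power4_eq_xxxx)
  have z: "\<zeta> = q / (R t)\<^sup>2" by (simp add: \<zeta> q_def power_divide)
  have w: "barrier_weight D f0 R R1 G x t * exp (- h t) = e q"
    by (simp add: barrier_weight_def e_def g_def q_def n_def)
  have wx: "barrier D f0 R R1 G h \<sigma> \<phi> x t = e q * \<phi> m"
    using w by (simp add: barrier_def m \<zeta>)
  have "e q * (f0 - n / 2 * (R1 t / R t) + g' * q - h1) * \<phi> m +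
      e q * (\<phi>1 m * (\<sigma>1 + 2 * q * R1 t / (R t)^3)) -
      D * (2 * n * F1 q + 4 * q * (e q * g * (g * \<phi> m - \<phi>1 m / (R t)\<^sup>2) +
      e q * (g * (\<phi>1 m * (- 1 / (R t)\<^sup>2)) - \<phi>2 * (- 1 / (R t)\<^sup>2) / (R t)\<^sup>2))) -
      f0 * (e q * \<phi> m) =
    e q * (\<phi> m * (- h1 - (n / 2 * (R1 t / R t) + 2 * D * n * g) + (g' - 4 * D * g\<^sup>2) * q) +
      \<phi>1 m * (\<sigma>1 + 2 * D * n / (R t)\<^sup>2 + (2 * q * R1 t / (R t)^3 + 8 * D * q * g / (R t)\<^sup>2)) -
      4 * D * q * \<phi>2 / (R t)^4)"
    unfolding F1_def Pq by (simp add: algebra_simps power2_eq_square power4_eq_xxxx)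
  also have "\<dots> = e q * (\<phi> m * (- h1 - D / (R t)\<^sup>2 * (2 * n * G t + 4 * \<zeta> * (G t)\<^sup>2)) +
       \<phi>1 m * (\<sigma>1 + D / (R t)\<^sup>2 * (2 * n + 8 * \<zeta> * G t)) - D / (R t)\<^sup>2 * 4 * \<zeta> * \<phi>2)"
    unfolding c3 c2 c1 z by (simp add: algebra_simps power2_eq_square power4_eq_xxxx)
  finally show ?thesis
    unfolding has_residual_def w
    by - (rule exI, rule exI, rule conjI[OF lap conjI[OF time]], simp add: wx)
qed

lemma continuous_on_barrier:
  assumes "continuous_on {t0..t1} R" "continuous_on {t0..t1} R1" "continuous_on {t0..t1} G"
    "continuous_on {t0..t1} h" "continuous_on {t0..t1} \<sigma>" "continuous_on {0..} \<phi>" "D > 0"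
    and pos: "\<And>t. t0 \<le> t \<Longrightarrow> t \<le> t1 \<Longrightarrow> R t > 0"
    and S: "\<And>x t. (x, t) \<in> S \<Longrightarrow> t0 \<le> t \<and> t \<le> t1 \<and> (norm x / R t)\<^sup>2 \<le> \<sigma> t"
  shows "continuous_on S (\<lambda>(x::'a::euclidean_space, t). barrier D f0 R R1 G h \<sigma> \<phi> x t)"
proof -
  have snd: "continuous_on S (\<lambda>z. f (snd z))" if "continuous_on {t0..t1} f" for f :: "real \<Rightarrow> real"
  proof (rule continuous_on_compose2[OF that continuous_on_snd[OF continuous_on_id]])
    show "snd ` S \<subseteq> {t0..t1}"
    proof (rule image_subsetI)
      fix z assume "z \<in> S"
      then show "snd z \<in> {t0..t1}" using S[of "fst z" "snd z"] by simp
    qed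
  qed
  note snd' = assms(1-5)[THEN snd]
  have pos': "R (snd z) > 0" if "z \<in> S" for z
  proof -
    have "t0 \<le> snd z \<and> snd z \<le> t1" using S[of "fst z" "snd z"] that by simp
    then show ?thesis using pos[of "snd z"] by blast
  qed
  have nz1: "\<forall>z\<in>S. R (snd z) \<noteq> 0"
  proof
    fix z assume "z \<in> S"
    from pos'[OF this] show "R (snd z) \<noteq> 0" by simp
  qed
  then have nz: "\<forall>z\<in>S. R (snd z) \<noteq> 0" "\<forall>z\<in>S. 4 * D * R (snd z) \<noteq> 0" "\<forall>z\<in>S. (R (snd z))\<^sup>2 \<noteq> 0"
    using \<open>D > 0\<close> by simp_all
  have P: "continuous_on S (\<lambda>z. \<sigma> (snd z) - (norm (fst z) / R (snd z))\<^sup>2)"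
    by (rule continuous_on_diff[OF snd'(5) continuous_on_power[OF continuous_on_divide[OF
          continuous_on_norm[OF continuous_on_fst[OF continuous_on_id]] snd'(1) nz1]]])
  have im: "(\<lambda>z. \<sigma> (snd z) - (norm (fst z) / R (snd z))\<^sup>2) ` S \<subseteq> {0..}"
  proof (rule image_subsetI)
    fix z assume "z \<in> S"
    then show "\<sigma> (snd z) - (norm (fst z) / R (snd z))\<^sup>2 \<in> {0..}"
      using S[of "fst z" "snd z"] by simp
  qed
  have \<phi>: "continuous_on S (\<lambda>z. \<phi> (\<sigma> (snd z) - (norm (fst z) / R (snd z))\<^sup>2))"
    by (rule continuous_on_compose2[OF assms(6) P im])
  show ?thesis
    unfolding barrier_def barrier_weight_def case_prod_unfold
    by (intro continuous_on_mult continuous_on_exp continuous_on_add continuous_on_diff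
        continuous_on_minus continuous_on_divide continuous_on_power continuous_on_ln
        continuous_on_norm continuous_on_fst continuous_on_snd continuous_on_const continuous_on_id
        snd' \<phi> nz)
qed

subsection \<open>Spreading of positivity\<close>

lemma continuous_on_moving_ball_solution:
  assumes "moving_ball_solution D f0 R \<psi>" "\<And>x t. (x, t) \<in> S \<Longrightarrow> 0 < t \<and> norm x \<le> R t"
  shows "continuous_on S (\<lambda>(x, t). \<psi> x t)"
  using assms unfolding moving_ball_solution_def by (auto intro: continuous_on_subset)

text \<open>Comparison with a multiple of
  \<open>exp (- l * t) * (r^2 - (norm (x - c t))^2)^2\<close> in a ball travelling with velocity
  \<open>v\<close>. Because of the outer square the Laplacian is strictly positive at the rim while
  the transport term vanishes there, so a large \<open>l\<close> yields a subsolution.\<close>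

lemma positivity_along_segment:
  fixes \<psi> :: "'a::euclidean_space \<Rightarrow> real \<Rightarrow> real"
  assumes "D > 0" and sol: "moving_ball_solution D f0 R \<psi>"
    and nonneg: "\<And>x t. t > 0 \<Longrightarrow> norm x \<le> R t \<Longrightarrow> \<psi> x t \<ge> 0"
    and "0 < t0" "t0 \<le> t1" "\<rho> > 0" "f0 \<ge> 0"
    and inside: "\<And>t. t0 \<le> t \<Longrightarrow> t \<le> t1 \<Longrightarrow> norm (x0 + (t - t0) *\<^sub>R v) + \<rho> \<le> R t"
    and pos: "\<psi> x0 t0 > 0"
  shows "\<psi> (x0 + (t1 - t0) *\<^sub>R v) t1 > 0"
proof -
  define n where "n = real DIM('a)"
  define c where "c t = x0 + (t - t0) *\<^sub>R v" for t
  have "continuous_on (cball 0 (R t0)) (\<lambda>x. (\<lambda>(x, t). \<psi> x t) (x, t0))"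
    by (rule continuous_on_compose2[OF continuous_on_moving_ball_solution[OF sol, of "cball 0 (R t0) \<times> {t0}"]])
       (use \<open>0 < t0\<close> in \<open>auto intro: continuous_intros\<close>)
  then have "continuous_on (cball 0 (R t0)) (\<lambda>x. \<psi> x t0)" by simp
  moreover have "x0 \<in> cball 0 (R t0)" using inside[of t0] \<open>t0 \<le> t1\<close> \<open>\<rho> > 0\<close> by simp
  ultimately obtain \<delta> where \<delta>: "\<delta> > 0"
      "\<And>x. x \<in> cball 0 (R t0) \<Longrightarrow> dist x x0 < \<delta> \<Longrightarrow> dist (\<psi> x t0) (\<psi> x0 t0) < \<psi> x0 t0 / 2"
    using pos unfolding continuous_on_iff by (meson half_gt_zero)
  define r where "r = min \<rho> (\<delta> / 2)"
  have r: "0 < r" "r \<le> \<rho>" "r < \<delta>" using \<open>\<rho> > 0\<close> \<delta>(1) by (auto simp: r_def)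
  have in_ball: "norm x \<le> R t" if "t0 \<le> t" "t \<le> t1" "norm (x - c t) \<le> r" for x t
    using inside[OF that(1,2)] that(3) r norm_triangle_sub[of x "c t"] unfolding c_def by linarith
  have in_ball': "norm x < R t" if "t0 \<le> t" "t \<le> t1" "norm (x - c t) < r" for x t
    using inside[OF that(1,2)] that(3) r norm_triangle_sub[of x "c t"] unfolding c_def by linarith
  \<comment> \<open>With \<open>m = r^2 - (norm z)^2\<close> the bracket in the residual will be at
    most \<open>- l * m^2 + b * m - 8 * D * r^2\<close>: the three terms of \<open>b\<close> come
    from transport, from the part of the Laplacian linear in \<open>m\<close>, and from replacing
    \<open>(norm z)^2\<close> by \<open>r^2 - m\<close>. The choice of \<open>l\<close> makes the
    discriminant zero, so the bound is minus a square.\<close>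
  define b where "b = 4 * r * norm v + 4 * n * D + 8 * D"
  define l where "l = b\<^sup>2 / (32 * D * r\<^sup>2)"
  \<comment> \<open>At \<open>t0\<close> the function \<open>W\<close> is at most
    \<open>exp (- l * t0) * r^4\<close>, so \<open>k * W\<close> starts below
    \<open>\<psi> x0 t0 / 2\<close>, and continuity keeps \<open>\<psi>\<close> above this value on
    the ball of radius \<open>r\<close>.\<close>
  define k where "k = \<psi> x0 t0 / 2 / r^4 * exp (l * t0)"
  have k: "k > 0" using pos r by (simp add: k_def)
  define W where "W x t = exp (- l * t) * (r\<^sup>2 - (norm (x - c t))\<^sup>2)\<^sup>2" for x t
  have "k * W (c t1) t1 \<le> \<psi> (c t1) t1"
  proof (rule tube_comparison_residual[where v = "\<lambda>x t. k * W x t" and c = c and r = "\<lambda>_. r"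
        and ?f0.0 = f0 and ?t0.0 = t0 and ?t1.0 = t1, OF \<open>D > 0\<close>])
    show "continuous_on {t0..t1} c" unfolding c_def by (intro continuous_intros)
    show "continuous_on {(x, t). t0 \<le> t \<and> t \<le> t1 \<and> norm (x - c t) \<le> r} (\<lambda>(x, t). k * W x t)"
      unfolding W_def c_def case_prod_unfold by (intro continuous_intros)
    show "continuous_on {(x, t). t0 \<le> t \<and> t \<le> t1 \<and> norm (x - c t) \<le> r} (\<lambda>(x, t). \<psi> x t)"
      using \<open>0 < t0\<close> in_ball by (intro continuous_on_moving_ball_solution[OF sol]) auto
    show "k * W x t0 \<le> \<psi> x t0" if "norm (x - c t0) \<le> r" for x
    proof -
      have nx: "norm x \<le> R t0" using in_ball that \<open>t0 \<le> t1\<close> by blast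
      have "dist x x0 < \<delta>" using that r by (simp add: c_def dist_norm)
      then have "\<bar>\<psi> x t0 - \<psi> x0 t0\<bar> < \<psi> x0 t0 / 2" using \<delta>(2)[of x] nx by (simp add: dist_real_def)
      then have "\<psi> x0 t0 / 2 \<le> \<psi> x t0" by linarith
      moreover have "(norm (x - c t0))\<^sup>2 \<le> r\<^sup>2" using that by (simp add: power_mono)
      then have "(r\<^sup>2 - (norm (x - c t0))\<^sup>2)\<^sup>2 \<le> (r\<^sup>2)\<^sup>2" by (intro power_mono) auto
      then have "(r\<^sup>2 - (norm (x - c t0))\<^sup>2)\<^sup>2 \<le> r^4" by (simp add: power_mult[symmetric])
      then have "k * W x t0 \<le> k * (exp (- l * t0) * r^4)"
        unfolding W_def using k by (intro mult_left_mono) auto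
      moreover have "k * (exp (- l * t0) * r^4) = \<psi> x0 t0 / 2"
        using r by (simp add: k_def exp_minus field_simps)
      ultimately show ?thesis by linarith
    qed
    show "k * W x t \<le> \<psi> x t" if "t0 \<le> t" "t \<le> t1" "norm (x - c t) = r" for x t
      using nonneg[of t x] in_ball[of t x] that \<open>0 < t0\<close> by (simp add: W_def)
    show "\<exists>\<rho> \<rho>'. has_residual D f0 (\<lambda>x t. k * W x t) x t \<rho> \<and> has_residual D f0 \<psi> x t \<rho>' \<and> \<rho> \<le> \<rho>'"
      if t: "t0 < t" "t \<le> t1" "norm (x - c t) < r" for x t
    proof (intro exI conjI)
      define z where "z = x - c t"
      define m where "m = r\<^sup>2 - (norm z)\<^sup>2"
      define F where "F q = exp (- l * t) * (r\<^sup>2 - q)\<^sup>2" for q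
      define F1 where "F1 q = exp (- l * t) * (- 2 * (r\<^sup>2 - q))" for q
      have "has_laplacian (\<lambda>y. F ((norm (y - c t))\<^sup>2))
          (2 * DIM('a) * F1 ((norm z)\<^sup>2) + 4 * (norm z)\<^sup>2 * (2 * exp (- l * t))) x"
        unfolding z_def
      proof (rule has_laplacian_radial)
        have "(F has_real_derivative F1 q) (at q)" for q
          unfolding F_def F1_def by (auto intro!: derivative_eq_intros)
        then show "\<forall>\<^sub>F q in nhds ((norm (x - c t))\<^sup>2). (F has_real_derivative F1 q) (at q)" by simp
        show "(F1 has_real_derivative 2 * exp (- l * t)) (at ((norm (x - c t))\<^sup>2))"
          unfolding F1_def by (auto intro!: derivative_eq_intros)
      qed
      then have lap: "has_laplacian (\<lambda>y. W y t)
          (exp (- l * t) * (8 * (norm z)\<^sup>2 - 4 * n * m)) x"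
        by (simp add: F_def F1_def W_def n_def m_def algebra_simps)
      have in1: "(norm (x - c s))\<^sup>2 = (x - x0) \<bullet> (x - x0) - 2 * (s - t0) * ((x - x0) \<bullet> v) + (s - t0)\<^sup>2 * (v \<bullet> v)" for s
        unfolding c_def power2_norm_eq_inner
        by (simp add: inner_diff_left inner_diff_right inner_add_left inner_add_right inner_commute
            power2_eq_square algebra_simps)
      have zv: "z \<bullet> v = (x - x0) \<bullet> v - (t - t0) * (v \<bullet> v)"
        by (simp add: z_def c_def inner_diff_left inner_add_left algebra_simps)
      define N where "N s = (norm (x - c s))\<^sup>2" for s
      have dN: "(N has_real_derivative - 2 * (z \<bullet> v)) (at t)"
        unfolding N_def in1 zv by (auto intro!: derivative_eq_intros simp: algebra_simps power2_eq_square)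
      have mN: "m = r\<^sup>2 - N t" by (simp add: m_def N_def z_def)
      have time: "((\<lambda>s. W x s) has_real_derivative
          exp (- l * t) * (- l * m\<^sup>2 + 4 * m * (z \<bullet> v))) (at t)"
        unfolding W_def N_def[symmetric]
        by (rule DERIV_cong, (rule derivative_intros dN)+)
           (simp add: mN algebra_simps power2_eq_square)
      have "has_residual D f0 W x t (exp (- l * t) *
          (- l * m\<^sup>2 + 4 * m * (z \<bullet> v) - D * (8 * (norm z)\<^sup>2 - 4 * n * m) - f0 * m\<^sup>2))"
        unfolding has_residual_def
        by (rule exI, rule exI, rule conjI[OF lap conjI[OF time]])
           (simp add: W_def m_def z_def algebra_simps)
      then show "has_residual D f0 (\<lambda>x t. k * W x t) x t (k * (exp (- l * t) *
          (- l * m\<^sup>2 + 4 * m * (z \<bullet> v) - D * (8 * (norm z)\<^sup>2 - 4 * n * m) - f0 * m\<^sup>2)))"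
        by (rule has_residual_cmult)
      show "has_residual D f0 \<psi> x t 0"
        using t \<open>0 < t0\<close> in_ball'[of t x] by (intro moving_ball_solution_residual[OF sol]) auto
      have z: "norm z < r" using t by (simp add: z_def)
      have m: "0 \<le> m" using z by (simp add: m_def power_mono)
      have "z \<bullet> v \<le> norm z * norm v" by (rule norm_cauchy_schwarz)
      also have "\<dots> \<le> r * norm v" using z by (intro mult_right_mono) auto
      finally have "m * (z \<bullet> v) \<le> m * (r * norm v)" using m by (rule mult_left_mono)
      moreover have e: "(norm z)\<^sup>2 = r\<^sup>2 - m" by (simp add: m_def)
      moreover have "f0 * m\<^sup>2 \<ge> 0" using \<open>f0 \<ge> 0\<close> by simp
      ultimately have "- l * m\<^sup>2 + 4 * m * (z \<bullet> v) - D * (8 * (norm z)\<^sup>2 - 4 * n * m) - f0 * m\<^sup>2 \<le>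
          - l * m\<^sup>2 + b * m - 8 * D * r\<^sup>2"
        unfolding e b_def by (simp add: algebra_simps)
      also have "\<dots> = - (b * m - 16 * D * r\<^sup>2)\<^sup>2 / (32 * D * r\<^sup>2)"
        using \<open>D > 0\<close> r by (simp add: l_def field_simps power2_eq_square)
      also have "\<dots> \<le> 0" using \<open>D > 0\<close> by (simp add: divide_nonpos_nonneg)
      finally show "k * (exp (- l * t) * (- l * m\<^sup>2 + 4 * m * (z \<bullet> v) -
          D * (8 * (norm z)\<^sup>2 - 4 * n * m) - f0 * m\<^sup>2)) \<le> 0"
        using k by (intro mult_nonneg_nonpos) auto
    qed
  qed (use \<open>t0 \<le> t1\<close> r in auto)
  moreover have "k * W (c t1) t1 > 0" using k r by (simp add: W_def)
  ultimately show ?thesis by (simp add: c_def)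
qed

text \<open>Two segments suffice. Within a time \<delta> so short that \<open>R\<close> hardly
  changes, the velocity \<open>- x0 / \<delta>\<close> carries positivity from \<open>x0\<close> to
  the origin; the velocity \<open>0\<close> then keeps it there, with the minimum of
  \<open>R\<close> over the time interval as radius.\<close>

lemma positivity_at_origin:
  fixes \<psi> :: "'a::euclidean_space \<Rightarrow> real \<Rightarrow> real"
  assumes "D > 0" "f0 \<ge> 0" and sol: "moving_ball_solution D f0 R \<psi>"
    and nonneg: "\<And>x t. t > 0 \<Longrightarrow> norm x \<le> R t \<Longrightarrow> \<psi> x t \<ge> 0"
    and R: "\<And>t. t > 0 \<Longrightarrow> R t > 0" "\<And>t. t > 0 \<Longrightarrow> isCont R t"
    and nonzero: "t0 > 0" "norm x0 \<le> R t0" "\<psi> x0 t0 \<noteq> 0"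
  shows "\<exists>t1>0. \<forall>t\<ge>t1. \<psi> 0 t > 0"
proof -
  have pos: "\<psi> x0 t0 > 0" using nonneg[OF nonzero(1,2)] nonzero(3) by simp
  have "norm x0 \<noteq> R t0" using sol nonzero unfolding moving_ball_solution_def by blast
  then have gap: "norm x0 < R t0" using nonzero(2) by simp
  \<comment> \<open>Half the gap: as long as \<open>R\<close> changes by less than \<rho>, a margin
    of \<rho> remains around every point of the segment.\<close>
  define \<rho> where "\<rho> = (R t0 - norm x0) / 2"
  have \<rho>: "\<rho> > 0" using gap by (simp add: \<rho>_def)
  obtain d where d: "d > 0" "\<And>t. \<bar>t - t0\<bar> < d \<Longrightarrow> \<bar>R t - R t0\<bar> < \<rho>"
    using R(2)[OF nonzero(1)] \<rho> unfolding continuous_at_eps_delta dist_real_def by blast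
  define \<delta> where "\<delta> = d / 2"
  have \<delta>: "\<delta> > 0" "\<delta> < d" using d(1) by (auto simp: \<delta>_def)
  have "\<psi> (x0 + (t0 + \<delta> - t0) *\<^sub>R ((- 1 / \<delta>) *\<^sub>R x0)) (t0 + \<delta>) > 0"
  proof (rule positivity_along_segment[OF \<open>D > 0\<close> sol nonneg nonzero(1) _ \<rho> \<open>f0 \<ge> 0\<close> _ pos])
    show "t0 \<le> t0 + \<delta>" using \<delta> by simp
    fix t assume t: "t0 \<le> t" "t \<le> t0 + \<delta>"
    have "x0 + (t - t0) *\<^sub>R ((- 1 / \<delta>) *\<^sub>R x0) = (1 - (t - t0) / \<delta>) *\<^sub>R x0"
      by (simp add: scaleR_diff_left)
    moreover have "0 \<le> (t - t0) / \<delta>" "(t - t0) / \<delta> \<le> 1" using t \<delta> by simp_all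
    ultimately have "norm (x0 + (t - t0) *\<^sub>R ((- 1 / \<delta>) *\<^sub>R x0)) \<le> norm x0"
      by (simp add: mult_left_le_one_le)
    moreover have "\<bar>R t - R t0\<bar> < \<rho>" using d(2)[of t] t \<delta> by simp
    moreover have "R t0 = norm x0 + 2 * \<rho>" by (simp add: \<rho>_def field_simps)
    ultimately show "norm (x0 + (t - t0) *\<^sub>R ((- 1 / \<delta>) *\<^sub>R x0)) + \<rho> \<le> R t"
      by linarith
  qed
  then have origin: "\<psi> 0 (t0 + \<delta>) > 0" using \<delta> by simp
  have "\<psi> 0 t > 0" if t: "t0 + \<delta> \<le> t" for t
  proof -
    have "continuous_on {t0 + \<delta>..t} R"
      using R(2) nonzero(1) \<delta> by (intro continuous_at_imp_continuous_on) auto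
    then obtain s where s: "s \<in> {t0 + \<delta>..t}" "\<And>t'. t' \<in> {t0 + \<delta>..t} \<Longrightarrow> R s \<le> R t'"
      using continuous_attains_inf[of "{t0 + \<delta>..t}" R] t by auto
    have "R s > 0" using R(1) s(1) nonzero(1) \<delta> by auto
    have "\<psi> (0 + (t - (t0 + \<delta>)) *\<^sub>R 0) t > 0"
      by (rule positivity_along_segment[OF \<open>D > 0\<close> sol nonneg _ t \<open>R s > 0\<close> \<open>f0 \<ge> 0\<close> _ origin])
         (use s nonzero(1) \<delta> in auto)
    then show ?thesis by simp
  qed
  then show ?thesis using nonzero(1) \<delta> by (intro exI[of _ "t0 + \<delta>"]) auto
qed

subsection \<open>Two-sided bounds in terms of the weight\<close>

text \<open>The profile \<open>m + m\<^sup>3\<^sup>/\<^sup>2\<close> vanishes linearly, but its second derivative blows up at \<open>m = 0\<close> and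
  there absorbs the drift; away from \<open>m = 0\<close> the decay rate \<open>h1\<close> does.\<close>

lemma subsolution_inequality:
  fixes a B G h1 m n \<sigma> \<sigma>0 \<sigma>1 \<zeta> :: real
  assumes "a > 0" "B \<ge> 3" "G \<ge> 0" "n \<ge> 0" "\<sigma>0 > 0" "\<sigma>0 \<le> \<sigma>" "\<sigma> \<le> 1" "\<sigma>1 \<ge> 0"
    and m: "m > 0" "m = \<sigma> - \<zeta>" and "\<zeta> \<ge> 0"
    and B: "5 / 2 * (\<sigma>1 + a * (2 * n + 8 * G)) \<le> a * B"
    and h1: "a * B^3 / (2 * \<sigma>0\<^sup>2) \<le> h1"
  shows "(m + m * sqrt m) * (- h1 - a * (2 * n * G + 4 * \<zeta> * G\<^sup>2)) +
    (1 + 3 / 2 * sqrt m) * (\<sigma>1 + a * (2 * n + 8 * \<zeta> * G)) - a * 4 * \<zeta> * (3 / 4 / sqrt m) \<le> 0"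
proof -
  define s where "s = sqrt m"
  have s: "0 < s" "m = s\<^sup>2" "s \<le> 1" using assms by (auto simp: s_def)
  have "0 \<le> a * B^3 / (2 * \<sigma>0\<^sup>2)" using assms by simp
  then have h1': "0 \<le> h1" using h1 by linarith
  have pos: "0 \<le> a * (2 * n * G + 4 * \<zeta> * G\<^sup>2)" using assms by simp
  have "m * h1 \<le> (m + m * s) * (h1 + a * (2 * n * G + 4 * \<zeta> * G\<^sup>2))"
    using m s h1' pos by (intro mult_mono) auto
  then have 1: "(m + m * s) * (- h1 - a * (2 * n * G + 4 * \<zeta> * G\<^sup>2)) \<le> - (m * h1)"
    by (simp add: algebra_simps)
  have "\<zeta> * G \<le> G" using assms by (intro mult_left_le_one_le) auto
  then have "a * (2 * n + 8 * \<zeta> * G) \<le> a * (2 * n + 8 * G)" using \<open>a > 0\<close> by simp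
  moreover have "0 \<le> a * (2 * n + 8 * \<zeta> * G)" using assms by simp
  \<comment> \<open>\<open>s \<le> 1\<close> bounds \<open>1 + 3 / 2 * s\<close> by
    \<open>5 / 2\<close>, whence this factor in the assumption on \<open>B\<close>.\<close>
  ultimately have "(1 + 3 / 2 * s) * (\<sigma>1 + a * (2 * n + 8 * \<zeta> * G)) \<le> 5 / 2 * (\<sigma>1 + a * (2 * n + 8 * G))"
    using s \<open>\<sigma>1 \<ge> 0\<close> by (intro mult_mono) auto
  then have 2: "(1 + 3 / 2 * s) * (\<sigma>1 + a * (2 * n + 8 * \<zeta> * G)) \<le> a * B" using B by linarith
  have 3: "a * B \<le> m * h1 + a * 3 * \<zeta> / s"
  \<comment> \<open>Below the threshold \<open>\<zeta> \<ge> 3 / 4 * \<sigma>0\<close>, and the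
    singular term \<open>a * 3 * \<zeta> / s\<close> alone is at least \<open>a * B\<close>. Above
    it \<open>m \<ge> (3 * \<sigma>0 / (2 * B))^2\<close>, and \<open>m * h1\<close> reaches
    \<open>9 / 8 * (a * B)\<close>; the cube of \<open>B\<close> and the square of
    \<open>\<sigma>0\<close> in the bound on \<open>h1\<close> come from this case.\<close>
  proof (cases "s \<le> 3 * \<sigma>0 / (2 * B)")
    case True
    then have sB: "s * (2 * B) \<le> 3 * \<sigma>0" using \<open>B \<ge> 3\<close> by (simp add: field_simps)
    have "s * 6 \<le> s * (2 * B)" using s \<open>B \<ge> 3\<close> by simp
    then have "s \<le> \<sigma>0 / 2" using sB by linarith
    then have "s * s \<le> \<sigma>0 / 2 * 1" using s \<open>\<sigma>0 > 0\<close> by (intro mult_mono) auto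
    then have "\<zeta> \<ge> \<sigma>0 / 2" "\<zeta> \<ge> 0" using m s assms by (auto simp: power2_eq_square)
    have "s * s \<le> \<sigma>0 / 2 * (1 / 2)" using \<open>s \<le> \<sigma>0 / 2\<close> s assms by (intro mult_mono) auto
    then have "\<zeta> \<ge> 3 / 4 * \<sigma>0" using m s assms by (auto simp: power2_eq_square)
    moreover have "2 * (B * s) \<le> 3 * \<sigma>0" using sB by (simp add: mult.commute mult.left_commute)
    ultimately have "B * s \<le> 3 * \<zeta>" using \<open>\<sigma>0 > 0\<close> by linarith
    then have "B \<le> 3 * \<zeta> / s" using s by (simp add: field_simps)
    then have "a * B \<le> a * (3 * \<zeta> / s)" using \<open>a > 0\<close> by (intro mult_left_mono) auto
    moreover have "0 \<le> m * h1" using m h1' by simp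
    ultimately show ?thesis by (simp add: mult.assoc)
  next
    case False
    then have "3 * \<sigma>0 / (2 * B) \<le> s" by simp
    then have "(3 * \<sigma>0 / (2 * B))\<^sup>2 \<le> m" unfolding s(2) using assms by (intro power_mono) auto
    then have "(3 * \<sigma>0 / (2 * B))\<^sup>2 * (a * B^3 / (2 * \<sigma>0\<^sup>2)) \<le> m * h1"
      using h1 m \<open>0 \<le> a * B^3 / (2 * \<sigma>0\<^sup>2)\<close> by (intro mult_mono) auto
    moreover have "(3 * \<sigma>0 / (2 * B))\<^sup>2 * (a * B^3 / (2 * \<sigma>0\<^sup>2)) = 9 / 8 * (a * B)"
      using assms by (simp add: field_simps power2_eq_square power3_eq_cube)
    moreover have "0 \<le> a * 3 * \<zeta> / s" using assms s by simp
    moreover have "0 \<le> a * B" using assms by simp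
    ultimately show ?thesis by linarith
  qed
  have "a * 4 * \<zeta> * (3 / 4 / s) = a * 3 * \<zeta> / s" by simp
  moreover have "p + q - r \<le> 0" if "p \<le> - u" "q \<le> w" "w \<le> u + v" "r = v" for p q r u v w :: real
    using that by linarith
  ultimately show ?thesis using 1 2 3 unfolding s_def[symmetric] by blast
qed

lemma DERIV_imp_continuous_on:
  fixes f :: "real \<Rightarrow> real"
  assumes "\<And>t. t \<in> S \<Longrightarrow> (f has_real_derivative f' t) (at t)"
  shows "continuous_on S f"
  using assms by (meson DERIV_isCont continuous_at_imp_continuous_on)

lemma profile_derivative:
  assumes "m > 0"
  shows "\<forall>\<^sub>F p in nhds m. ((\<lambda>p. p + p * sqrt p) has_real_derivative 1 + 3 / 2 * sqrt p) (at p)"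
    and "((\<lambda>p. 1 + 3 / 2 * sqrt p) has_real_derivative 3 / 4 / sqrt m) (at m)"
proof -
  have "\<forall>\<^sub>F p in nhds m. p \<in> {0<..}" by (intro eventually_nhds_in_open) (use assms in auto)
  then show "\<forall>\<^sub>F p in nhds m. ((\<lambda>p. p + p * sqrt p) has_real_derivative 1 + 3 / 2 * sqrt p) (at p)"
  proof eventually_elim
    case (elim p)
    then have p: "p > 0" by simp
    have "p * inverse (sqrt p) = sqrt p"
      using real_div_sqrt[OF less_imp_le[OF p]] by (simp only: divide_inverse)
    then have "1 + (1 * sqrt p + inverse (sqrt p) / 2 * p) = 1 + 3 / 2 * sqrt p"
      by (simp only: times_divide_eq_left mult.commute[of _ p])
    with DERIV_add[OF DERIV_ident DERIV_mult[OF DERIV_ident DERIV_real_sqrt[OF p]]]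
    show ?case by (rule DERIV_cong)
  qed
  have "0 + 3 / 2 * (inverse (sqrt m) / 2) = 3 / 4 / sqrt m" by (simp add: field_simps)
  with DERIV_add[OF DERIV_const[of 1] DERIV_cmult[OF DERIV_real_sqrt[OF assms], of "3 / 2"]]
  show "((\<lambda>p. 1 + 3 / 2 * sqrt p) has_real_derivative 3 / 4 / sqrt m) (at m)"
    by (rule DERIV_cong)
qed

section \<open>Comparison with the barriers over a time interval\<close>

locale moving_ball_weights =
  fixes D f0 T0 :: real and R R1 R2 G :: "real \<Rightarrow> real"
    and \<psi> :: "'a::euclidean_space \<Rightarrow> real \<Rightarrow> real"
  assumes D_pos: "D > 0" and T0_pos: "T0 > 0"
    and R_pos: "\<And>t. t \<ge> T0 \<Longrightarrow> R t > 0"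
    and R_deriv: "\<And>t. t \<ge> T0 \<Longrightarrow> (R has_real_derivative R1 t) (at t)"
    and R1_deriv: "\<And>t. t \<ge> T0 \<Longrightarrow> (R1 has_real_derivative R2 t) (at t)"
    and G_deriv: "\<And>t. t \<ge> T0 \<Longrightarrow> (G has_real_derivative R t * R2 t / (4 * D)) (at t)"
    and G_nonneg: "\<And>t. t \<ge> T0 \<Longrightarrow> G t \<ge> 0"
    and sol: "moving_ball_solution D f0 R \<psi>"
    and nonneg: "\<And>x t. t > 0 \<Longrightarrow> norm x \<le> R t \<Longrightarrow> \<psi> x t \<ge> 0"
begin

definition n :: real where "n = real DIM('a)"

lemma n_nonneg: "n \<ge> 0" by (simp add: n_def)

abbreviation weight :: "'a \<Rightarrow> real \<Rightarrow> real" where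
  "weight \<equiv> barrier_weight D f0 R R1 G"

abbreviation supersolution :: "(real \<Rightarrow> real) \<Rightarrow> (real \<Rightarrow> real) \<Rightarrow> 'a \<Rightarrow> real \<Rightarrow> real" where
  "supersolution h \<sigma> \<equiv> barrier D f0 R R1 G h \<sigma> (\<lambda>p. p)"

abbreviation subsolution :: "(real \<Rightarrow> real) \<Rightarrow> (real \<Rightarrow> real) \<Rightarrow> 'a \<Rightarrow> real \<Rightarrow> real" where
  "subsolution h \<sigma> \<equiv> barrier D f0 R R1 G h \<sigma> (\<lambda>p. p + p * sqrt p)"

lemma weight_pos: "weight x t > 0"
  by (simp add: barrier_weight_def)

lemma cont_data:
  assumes "T0 \<le> t0"
  shows "continuous_on {t0..t1} R" "continuous_on {t0..t1} R1" "continuous_on {t0..t1} G"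
  using assms by (auto intro!: DERIV_imp_continuous_on R_deriv R1_deriv G_deriv)

lemma barrier_continuous:
  assumes "T0 \<le> t0" "\<And>t. T0 \<le> t \<Longrightarrow> (h has_real_derivative h1 t) (at t)"
    "\<And>t. T0 \<le> t \<Longrightarrow> (\<sigma> has_real_derivative \<sigma>1) (at t)" "continuous_on {0..} \<phi>"
    "\<And>x t. (x, t) \<in> S \<Longrightarrow> t0 \<le> t \<and> t \<le> t1 \<and> (norm x / R t)\<^sup>2 \<le> \<sigma> t"
  shows "continuous_on S (\<lambda>(x::'a, t). barrier D f0 R R1 G h \<sigma> \<phi> x t)"
  by (rule continuous_on_barrier[OF cont_data[OF assms(1)] DERIV_imp_continuous_on
        DERIV_imp_continuous_on assms(4) D_pos _ assms(5)])
     (use assms(1) in \<open>auto intro: assms(2,3) R_pos\<close>)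

lemma relative_radius:
  assumes "T0 \<le> t" "s \<ge> 0"
  shows "(norm x / R t)\<^sup>2 \<le> s \<longleftrightarrow> norm x \<le> sqrt s * R t"
    and "(norm x / R t)\<^sup>2 < s \<longleftrightarrow> norm x < sqrt s * R t"
proof -
  have R: "R t > 0" using R_pos assms by simp
  then have y: "norm x / R t \<ge> 0" by simp
  have "(norm x / R t)\<^sup>2 \<le> s \<longleftrightarrow> norm x / R t \<le> sqrt s"
    using real_sqrt_le_iff[of "(norm x / R t)\<^sup>2" s] y by (simp only: real_sqrt_abs abs_of_nonneg)
  then show "(norm x / R t)\<^sup>2 \<le> s \<longleftrightarrow> norm x \<le> sqrt s * R t" using R by (simp only: pos_divide_le_eq)
  have "(norm x / R t)\<^sup>2 < s \<longleftrightarrow> norm x / R t < sqrt s"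
    using real_sqrt_less_iff[of "(norm x / R t)\<^sup>2" s] y by (simp only: real_sqrt_abs abs_of_nonneg)
  then show "(norm x / R t)\<^sup>2 < s \<longleftrightarrow> norm x < sqrt s * R t" using R by (simp only: pos_divide_less_eq)
qed

text \<open>The profile \<open>p\<close> has no second derivative term, and
  \<open>G t \<ge> 0\<close> gives the drift the good sign. Only the zero order term has to be
  outweighed, by \<open>- h1\<close>, and the remaining \<open>2 * n * D / (R t)^2\<close> leaves
  room for \<sigma> to decrease.\<close>

lemma upper_step:
  assumes t01: "T0 \<le> t0" "t0 \<le> t1"
    and h: "\<And>t. T0 \<le> t \<Longrightarrow> (h has_real_derivative h1 t) (at t)"
    and \<sigma>: "\<And>t. T0 \<le> t \<Longrightarrow> (\<sigma> has_real_derivative \<sigma>1) (at t)"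
    and \<sigma>_ge: "\<And>t. t0 \<le> t \<Longrightarrow> t \<le> t1 \<Longrightarrow> 1 \<le> \<sigma> t"
    and \<sigma>1: "\<And>t. t0 \<le> t \<Longrightarrow> t \<le> t1 \<Longrightarrow> - (2 * n * D / (R t)\<^sup>2) \<le> \<sigma>1"
    and h1: "\<And>t. t0 \<le> t \<Longrightarrow> t \<le> t1 \<Longrightarrow> D / (R t)\<^sup>2 * (2 * n * G t + 4 * (G t)\<^sup>2) \<le> - h1 t"
    and "M \<ge> 0" and init: "\<And>x. norm x \<le> R t0 \<Longrightarrow> \<psi> x t0 \<le> M * supersolution h \<sigma> x t0"
    and "t0 \<le> t" "t \<le> t1" "norm x \<le> R t"
  shows "\<psi> x t \<le> M * supersolution h \<sigma> x t"
proof (rule tube_comparison_residual[where w = "\<lambda>x t. M * supersolution h \<sigma> x t" and c = "\<lambda>_. 0"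
      and r = R and ?f0.0 = f0 and ?t0.0 = t0 and ?t1.0 = t1, OF D_pos])
  have \<zeta>: "(norm x / R t)\<^sup>2 \<le> 1" if "t0 \<le> t" "norm x \<le> R t" for x :: 'a and t
    using relative_radius(1)[of t 1 x] that t01 by simp
  show "continuous_on {t0..t1} (\<lambda>_. 0::'a)" by simp
  show "continuous_on {t0..t1} R" using cont_data t01 by blast
  show "continuous_on {(x, t). t0 \<le> t \<and> t \<le> t1 \<and> norm (x - 0) \<le> R t} (\<lambda>(x, t). \<psi> x t)"
    by (intro continuous_on_moving_ball_solution[OF sol]) (use t01 T0_pos in auto)
  have "continuous_on {(x, t). t0 \<le> t \<and> t \<le> t1 \<and> norm (x - 0) \<le> R t} (\<lambda>(x, t). supersolution h \<sigma> x t)"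
  proof (rule barrier_continuous[OF t01(1) h \<sigma>])
    fix x :: 'a and t assume "(x, t) \<in> {(x, t). t0 \<le> t \<and> t \<le> t1 \<and> norm (x - 0) \<le> R t}"
    then show "t0 \<le> t \<and> t \<le> t1 \<and> (norm x / R t)\<^sup>2 \<le> \<sigma> t"
      using \<zeta>[of t x] \<sigma>_ge[of t] by auto
  qed (auto intro: continuous_intros)
  then show "continuous_on {(x, t). t0 \<le> t \<and> t \<le> t1 \<and> norm (x - 0) \<le> R t}
      (\<lambda>(x, t). M * supersolution h \<sigma> x t)"
    unfolding case_prod_unfold by (intro continuous_on_mult continuous_on_const)
  show "\<psi> x t0 \<le> M * supersolution h \<sigma> x t0" if "norm (x - 0) \<le> R t0" for x
    using init that by simp
  show "\<psi> x t \<le> M * supersolution h \<sigma> x t" if "t0 \<le> t" "t \<le> t1" "norm (x - 0) = R t" for x t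
  proof -
    have "\<psi> x t = 0" using sol that t01 T0_pos unfolding moving_ball_solution_def by auto
    moreover have "(norm x / R t)\<^sup>2 \<le> \<sigma> t" using \<zeta>[of t x] \<sigma>_ge[of t] that by auto
    ultimately show ?thesis
      using \<open>M \<ge> 0\<close> weight_pos[of x t] by (simp add: barrier_def less_imp_le)
  qed
  show "\<exists>\<rho> \<rho>'. has_residual D f0 \<psi> x t \<rho> \<and>
      has_residual D f0 (\<lambda>x t. M * supersolution h \<sigma> x t) x t \<rho>' \<and> \<rho> \<le> \<rho>'"
    if t: "t0 < t" "t \<le> t1" "norm (x - 0) < R t" for x t
  proof (intro exI conjI)
    define \<zeta>x where "\<zeta>x = (norm x / R t)\<^sup>2"
    have tT: "T0 \<le> t" using t t01 by simp
    show "has_residual D f0 \<psi> x t 0"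
      by (intro moving_ball_solution_residual[OF sol]) (use t t01 T0_pos in auto)
    have "has_residual D f0 (supersolution h \<sigma>) x t (weight x t * exp (- h t) *
      ((\<sigma> t - \<zeta>x) * (- h1 t - D / (R t)\<^sup>2 * (2 * real DIM('a) * G t + 4 * \<zeta>x * (G t)\<^sup>2)) +
       1 * (\<sigma>1 + D / (R t)\<^sup>2 * (2 * real DIM('a) + 8 * \<zeta>x * G t)) - D / (R t)\<^sup>2 * 4 * \<zeta>x * 0))"
      by (intro barrier_residual[where ?R2.0 = "R2 t" and ?\<phi>1.0 = "\<lambda>_. 1" and ?\<phi>2.0 = 0] D_pos R_pos R_deriv R1_deriv G_deriv h \<sigma>) (use tT in \<open>auto simp: \<zeta>x_def intro!: derivative_eq_intros\<close>)
    then show "has_residual D f0 (\<lambda>x t. M * supersolution h \<sigma> x t) x t (M * (weight x t * exp (- h t) *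
      ((\<sigma> t - \<zeta>x) * (- h1 t - D / (R t)\<^sup>2 * (2 * n * G t + 4 * \<zeta>x * (G t)\<^sup>2)) +
       (\<sigma>1 + D / (R t)\<^sup>2 * (2 * n + 8 * \<zeta>x * G t)))))"
      unfolding n_def by (intro has_residual_cmult) simp
    have z: "0 \<le> \<zeta>x" "\<zeta>x \<le> 1" using \<zeta>[of t x] t by (auto simp: \<zeta>x_def)
    have a: "0 \<le> D / (R t)\<^sup>2" using D_pos by simp
    have G: "0 \<le> G t" using G_nonneg tT by simp
    have "\<zeta>x * (G t)\<^sup>2 \<le> (G t)\<^sup>2" by (intro mult_left_le_one_le) (use z in auto)
    then have "D / (R t)\<^sup>2 * (2 * n * G t + 4 * \<zeta>x * (G t)\<^sup>2) \<le> D / (R t)\<^sup>2 * (2 * n * G t + 4 * (G t)\<^sup>2)"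
      by (intro mult_left_mono) (use a in auto)
    then have "0 \<le> - h1 t - D / (R t)\<^sup>2 * (2 * n * G t + 4 * \<zeta>x * (G t)\<^sup>2)"
      using h1[of t] t by linarith
    moreover have "0 \<le> \<sigma> t - \<zeta>x" using z \<sigma>_ge[of t] t by simp
    moreover have "0 \<le> \<sigma>1 + D / (R t)\<^sup>2 * (2 * n + 8 * \<zeta>x * G t)"
    proof -
      have "D / (R t)\<^sup>2 * (2 * n) \<le> D / (R t)\<^sup>2 * (2 * n + 8 * \<zeta>x * G t)"
        by (intro mult_left_mono) (use a z G in auto)
      then show ?thesis using \<sigma>1[of t] t by (simp add: mult.commute)
    qed
    ultimately show "0 \<le> M * (weight x t * exp (- h t) *
      ((\<sigma> t - \<zeta>x) * (- h1 t - D / (R t)\<^sup>2 * (2 * n * G t + 4 * \<zeta>x * (G t)\<^sup>2)) +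
       (\<sigma>1 + D / (R t)\<^sup>2 * (2 * n + 8 * \<zeta>x * G t))))"
      using \<open>M \<ge> 0\<close> weight_pos[of x t]
      by (metis add_nonneg_nonneg exp_ge_zero less_imp_le mult_nonneg_nonneg)
  qed
qed (use assms in auto)

text \<open>The comparison takes place in the ball of radius \<open>sqrt (\<sigma> t) * R t\<close>:
  the barrier vanishes on its rim, so nonnegativity of \<psi> settles the lateral boundary, and
  \<open>m > 0\<close> inside, where the profile is twice differentiable. \<open>B\<close> depends
  on time since it has to follow \<open>G\<close> and, while the zero moves, also
  \<open>\<sigma>1 * (R t)^2\<close>.\<close>

lemma lower_step:
  assumes t01: "T0 \<le> t0" "t0 \<le> t1"
    and h: "\<And>t. T0 \<le> t \<Longrightarrow> (h has_real_derivative h1 t) (at t)"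
    and \<sigma>: "\<And>t. T0 \<le> t \<Longrightarrow> (\<sigma> has_real_derivative \<sigma>1) (at t)"
    and "0 < \<sigma>0" "0 \<le> \<sigma>1" "\<epsilon> \<ge> 0"
    and \<sigma>_bds: "\<And>t. t0 \<le> t \<Longrightarrow> t \<le> t1 \<Longrightarrow> \<sigma>0 \<le> \<sigma> t \<and> \<sigma> t \<le> 1"
    and B: "\<And>t. t0 \<le> t \<Longrightarrow> t \<le> t1 \<Longrightarrow> 3 \<le> B t \<and>
        5 / 2 * (\<sigma>1 + D / (R t)\<^sup>2 * (2 * n + 8 * G t)) \<le> D / (R t)\<^sup>2 * B t"
    and h1: "\<And>t. t0 \<le> t \<Longrightarrow> t \<le> t1 \<Longrightarrow> D / (R t)\<^sup>2 * (B t)^3 / (2 * \<sigma>0\<^sup>2) \<le> h1 t"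
    and init: "\<And>x. norm x \<le> sqrt (\<sigma> t0) * R t0 \<Longrightarrow> \<epsilon> * subsolution h \<sigma> x t0 \<le> \<psi> x t0"
    and "t0 \<le> t" "t \<le> t1" "norm x \<le> sqrt (\<sigma> t) * R t"
  shows "\<epsilon> * subsolution h \<sigma> x t \<le> \<psi> x t"
proof (rule tube_comparison_residual[where v = "\<lambda>x t. \<epsilon> * subsolution h \<sigma> x t" and c = "\<lambda>_. 0"
      and r = "\<lambda>t. sqrt (\<sigma> t) * R t" and ?f0.0 = f0 and ?t0.0 = t0 and ?t1.0 = t1, OF D_pos])
  have \<sigma>0: "0 \<le> \<sigma> t" if "t0 \<le> t" "t \<le> t1" for t using \<sigma>_bds[OF that] \<open>0 < \<sigma>0\<close> by simp
  have R: "sqrt (\<sigma> t) * R t \<le> R t" if "t0 \<le> t" "t \<le> t1" for t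
    by (intro mult_left_le_one_le) (use \<sigma>0[OF that] \<sigma>_bds[OF that] R_pos[of t] that t01 in auto)
  show "continuous_on {t0..t1} (\<lambda>_. 0::'a)" by simp
  show "continuous_on {t0..t1} (\<lambda>t. sqrt (\<sigma> t) * R t)"
    using t01 by (intro continuous_on_mult continuous_on_real_sqrt cont_data
        DERIV_imp_continuous_on[of _ \<sigma> "\<lambda>_. \<sigma>1"]) (auto intro: \<sigma>)
  show "continuous_on {(x, t). t0 \<le> t \<and> t \<le> t1 \<and> norm (x - 0) \<le> sqrt (\<sigma> t) * R t} (\<lambda>(x, t). \<psi> x t)"
    by (intro continuous_on_moving_ball_solution[OF sol]) (use t01 T0_pos R in force)
  have "continuous_on {(x, t). t0 \<le> t \<and> t \<le> t1 \<and> norm (x - 0) \<le> sqrt (\<sigma> t) * R t}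
      (\<lambda>(x, t). subsolution h \<sigma> x t)"
  proof (rule barrier_continuous[OF t01(1) h \<sigma>])
    fix x :: 'a and t
    assume "(x, t) \<in> {(x, t). t0 \<le> t \<and> t \<le> t1 \<and> norm (x - 0) \<le> sqrt (\<sigma> t) * R t}"
    then show "t0 \<le> t \<and> t \<le> t1 \<and> (norm x / R t)\<^sup>2 \<le> \<sigma> t"
      using relative_radius(1)[of t "\<sigma> t" x] \<sigma>0[of t] t01 by auto
  qed (auto intro!: continuous_intros)
  then show "continuous_on {(x, t). t0 \<le> t \<and> t \<le> t1 \<and> norm (x - 0) \<le> sqrt (\<sigma> t) * R t}
      (\<lambda>(x, t). \<epsilon> * subsolution h \<sigma> x t)"
    unfolding case_prod_unfold by (intro continuous_on_mult continuous_on_const)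
  show "\<epsilon> * subsolution h \<sigma> x t0 \<le> \<psi> x t0" if "norm (x - 0) \<le> sqrt (\<sigma> t0) * R t0" for x
    using init that by simp
  show "\<epsilon> * subsolution h \<sigma> x t \<le> \<psi> x t"
    if t: "t0 \<le> t" "t \<le> t1" "norm (x - 0) = sqrt (\<sigma> t) * R t" for x t
  proof -
    have "R t > 0" using R_pos t t01 by simp
    then have "(norm x / R t)\<^sup>2 = \<sigma> t" using t \<sigma>0[of t] by simp
    then have "subsolution h \<sigma> x t = 0" by (simp add: barrier_def)
    moreover have "0 \<le> \<psi> x t" using nonneg[of t x] t R[of t] t01 T0_pos by auto
    ultimately show ?thesis by simp
  qed
  show "\<exists>\<rho> \<rho>'. has_residual D f0 (\<lambda>x t. \<epsilon> * subsolution h \<sigma> x t) x t \<rho> \<and>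
      has_residual D f0 \<psi> x t \<rho>' \<and> \<rho> \<le> \<rho>'"
    if t: "t0 < t" "t \<le> t1" "norm (x - 0) < sqrt (\<sigma> t) * R t" for x t
  proof (intro exI conjI)
    define \<zeta> where "\<zeta> = (norm x / R t)\<^sup>2"
    define m where "m = \<sigma> t - \<zeta>"
    have tT: "T0 \<le> t" using t t01 by simp
    have m: "m > 0" using relative_radius(2)[of t "\<sigma> t" x] t tT \<sigma>0[of t] by (simp add: m_def \<zeta>_def)
    show "has_residual D f0 \<psi> x t 0"
      by (intro moving_ball_solution_residual[OF sol]) (use t t01 T0_pos R[of t] in auto)
    have "has_residual D f0 (subsolution h \<sigma>) x t (weight x t * exp (- h t) *
      ((m + m * sqrt m) * (- h1 t - D / (R t)\<^sup>2 * (2 * real DIM('a) * G t + 4 * \<zeta> * (G t)\<^sup>2)) +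
       (1 + 3 / 2 * sqrt m) * (\<sigma>1 + D / (R t)\<^sup>2 * (2 * real DIM('a) + 8 * \<zeta> * G t)) -
       D / (R t)\<^sup>2 * 4 * \<zeta> * (3 / 4 / sqrt m)))"
      by (intro barrier_residual[where ?R2.0 = "R2 t" and ?\<phi>1.0 = "\<lambda>p. 1 + 3 / 2 * sqrt p" and ?\<phi>2.0 = "3 / 4 / sqrt m"]
          D_pos R_pos R_deriv R1_deriv G_deriv h \<sigma> \<zeta>_def m_def profile_derivative m tT)
    then show "has_residual D f0 (\<lambda>x t. \<epsilon> * subsolution h \<sigma> x t) x t (\<epsilon> * (weight x t * exp (- h t) *
      ((m + m * sqrt m) * (- h1 t - D / (R t)\<^sup>2 * (2 * n * G t + 4 * \<zeta> * (G t)\<^sup>2)) +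
       (1 + 3 / 2 * sqrt m) * (\<sigma>1 + D / (R t)\<^sup>2 * (2 * n + 8 * \<zeta> * G t)) -
       D / (R t)\<^sup>2 * 4 * \<zeta> * (3 / 4 / sqrt m))))"
      unfolding n_def by (rule has_residual_cmult)
    have "(m + m * sqrt m) * (- h1 t - D / (R t)\<^sup>2 * (2 * n * G t + 4 * \<zeta> * (G t)\<^sup>2)) +
       (1 + 3 / 2 * sqrt m) * (\<sigma>1 + D / (R t)\<^sup>2 * (2 * n + 8 * \<zeta> * G t)) -
       D / (R t)\<^sup>2 * 4 * \<zeta> * (3 / 4 / sqrt m) \<le> 0"
      by (rule subsolution_inequality[where B = "B t" and \<sigma> = "\<sigma> t" and ?\<sigma>0.0 = \<sigma>0 and n = n])
         (use \<open>0 < \<sigma>0\<close> \<open>0 \<le> \<sigma>1\<close> B[of t] h1[of t] \<sigma>_bds[of t] t tT R_pos[of t] D_pos G_nonneg[of t]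
            n_nonneg m in \<open>simp_all add: \<zeta>_def m_def\<close>)
    then show "\<epsilon> * (weight x t * exp (- h t) *
      ((m + m * sqrt m) * (- h1 t - D / (R t)\<^sup>2 * (2 * n * G t + 4 * \<zeta> * (G t)\<^sup>2)) +
       (1 + 3 / 2 * sqrt m) * (\<sigma>1 + D / (R t)\<^sup>2 * (2 * n + 8 * \<zeta> * G t)) -
       D / (R t)\<^sup>2 * 4 * \<zeta> * (3 / 4 / sqrt m))) \<le> 0"
      by (intro mult_nonneg_nonpos) (use \<open>\<epsilon> \<ge> 0\<close> weight_pos[of x t] in auto)
  qed
qed (use assms in auto)

end

lemma continuous_on_time_slice:
  assumes "continuous_on (A \<times> {t}) (\<lambda>(x, t). u x t)"
  shows "continuous_on A (\<lambda>x. u x t)"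
proof -
  have "continuous_on A (\<lambda>x. (\<lambda>(x, t). u x t) (x, t))"
    by (rule continuous_on_compose2[OF assms]) (auto intro: continuous_intros)
  then show ?thesis by simp
qed

lemma continuous_bounded_above_on_compact:
  fixes f :: "'b::topological_space \<Rightarrow> real"
  assumes "compact S" "continuous_on S f"
  obtains M where "M > 0" "\<And>x. x \<in> S \<Longrightarrow> f x \<le> M"
proof -
  have "bounded (f ` S)" using assms by (intro compact_imp_bounded compact_continuous_image)
  then obtain b where "\<And>x. x \<in> S \<Longrightarrow> \<bar>f x\<bar> \<le> b" unfolding bounded_iff by auto
  then have "f x \<le> max b 1" if "x \<in> S" for x using that by fastforce
  then show thesis by (intro that[of "max b 1"]) auto
qed

context moving_ball_weights
begin

lemma n_pos: "n > 0" by (simp add: n_def)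

lemma slice_continuous:
  assumes "T0 \<le> t" "\<And>t. T0 \<le> t \<Longrightarrow> (h has_real_derivative h1 t) (at t)"
    "\<And>t. T0 \<le> t \<Longrightarrow> (\<sigma> has_real_derivative \<sigma>1) (at t)" "continuous_on {0..} \<phi>"
    "s \<ge> 0" "s \<le> \<sigma> t"
  shows "continuous_on (cball (0::'a) (sqrt s * R t)) (\<lambda>x. barrier D f0 R R1 G h \<sigma> \<phi> x t)"
proof (rule continuous_on_time_slice, rule barrier_continuous[OF assms(1-4)])
  fix x :: 'a and t' assume "(x, t') \<in> cball 0 (sqrt s * R t) \<times> {t}"
  then have "t' = t" "norm x \<le> sqrt s * R t" by auto
  then have "(norm x / R t)\<^sup>2 \<le> s" using relative_radius(1)[OF assms(1,5)] by blast
  then show "t \<le> t' \<and> t' \<le> t \<and> (norm x / R t')\<^sup>2 \<le> \<sigma> t'" using \<open>t' = t\<close> assms(6) by simp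
qed

lemma solution_slice_continuous:
  assumes "T0 \<le> t" shows "continuous_on (cball 0 (R t)) (\<lambda>x. \<psi> x t)"
  by (rule continuous_on_time_slice, rule continuous_on_moving_ball_solution[OF sol])
     (use assms T0_pos in auto)

context
  fixes h h1 :: "real \<Rightarrow> real"
  assumes h: "\<And>t. T0 \<le> t \<Longrightarrow> (h has_real_derivative h1 t) (at t)"
    and h1: "\<And>t. T0 \<le> t \<Longrightarrow> D / (R t)\<^sup>2 * (5 * n + 20 * G t + 3)^3 / 2 \<le> h1 t"
begin

text \<open>One rate serves both barriers: the cube needed by the subsolution dominates the
  quadratic expression needed by the supersolution. The base \<open>5 * n + 20 * G t + 3\<close> is
  \<open>5 / 2 * (2 * n + 8 * G t)\<close>, the demand on \<open>B\<close> when the zero rests, plus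
  \<open>3\<close> to ensure \<open>B \<ge> 3\<close>.\<close>

lemma h1_ge:
  assumes "T0 \<le> t"
  shows "0 \<le> h1 t" and "D / (R t)\<^sup>2 * (2 * n * G t + 4 * (G t)\<^sup>2) \<le> h1 t"
proof -
  define b where "b = 5 * n + 20 * G t + 3"
  have G: "0 \<le> G t" using G_nonneg assms by simp
  have b: "3 \<le> b" using G n_nonneg by (simp add: b_def)
  have a: "0 \<le> D / (R t)\<^sup>2" using D_pos by simp
  have "0 \<le> b^3" using b by simp
  with a have "0 \<le> D / (R t)\<^sup>2 * b^3" by (rule mult_nonneg_nonneg)
  then have "0 \<le> D / (R t)\<^sup>2 * b^3 / 2" by (rule divide_nonneg_pos) simp
  then show "0 \<le> h1 t" using h1[OF assms] unfolding b_def by (rule order_trans)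
  have "2 * (n * G t) + 4 * (G t)\<^sup>2 \<le> b\<^sup>2"
  proof -
    have "0 \<le> n * n" "0 \<le> n * G t" "0 \<le> G t * G t" using G n_nonneg by auto
    then show ?thesis unfolding b_def power2_eq_square using G n_nonneg by (simp add: algebra_simps)
  qed
  also have "b\<^sup>2 \<le> b^3 / 2"
  proof -
    have "2 * b\<^sup>2 \<le> b * b\<^sup>2" using b by (intro mult_right_mono) auto
    then show ?thesis by (simp add: power2_eq_square power3_eq_cube)
  qed
  finally have "2 * n * G t + 4 * (G t)\<^sup>2 \<le> b^3 / 2" by (simp only: mult.assoc)
  then have "D / (R t)\<^sup>2 * (2 * n * G t + 4 * (G t)\<^sup>2) \<le> D / (R t)\<^sup>2 * (b^3 / 2)"
    using a by (rule mult_left_mono)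
  also have "\<dots> \<le> h1 t" using h1[OF assms] by (simp only: b_def times_divide_eq_right)
  finally show "D / (R t)\<^sup>2 * (2 * n * G t + 4 * (G t)\<^sup>2) \<le> h1 t" .
qed

text \<open>On \<open>[T0, T0 + 1]\<close> the zero of the barrier moves from outside the ball onto its boundary: this
  turns boundedness of \<open>\<psi>\<close> at time \<open>T0\<close> into linear vanishing at time \<open>T0 + 1\<close>.\<close>

lemma upper_bound:
  "\<exists>M>0. \<forall>t\<ge>T0 + 1. \<forall>x. norm x \<le> R t \<longrightarrow>
     \<psi> x t \<le> M * (weight x t * (exp (h t) * (1 - (norm x / R t)\<^sup>2)))"
proof -
  have hm: "((\<lambda>t. - h t) has_real_derivative - h1 t) (at t)" if "T0 \<le> t" for t
    using h[OF that] by (rule DERIV_minus)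
  obtain Rm where Rm: "Rm > 0" "\<And>t. t \<in> {T0..T0 + 1} \<Longrightarrow> R t \<le> Rm"
    by (rule continuous_bounded_above_on_compact[OF compact_Icc cont_data(1)[OF order_refl]]) blast
  \<comment> \<open>\<open>upper_step\<close> lets \<sigma> decrease no faster than
    \<open>2 * n * D / (R t)^2\<close>; the bound \<open>Rm\<close> turns this into a rate valid on
    the whole unit of time, during which \<sigma> falls from \<open>1 + \<kappa>\<close> to
    \<open>1\<close>.\<close>
  define \<kappa> where "\<kappa> = 2 * n * D / Rm\<^sup>2"
  have \<kappa>: "\<kappa> > 0" using n_pos D_pos Rm(1) by (simp add: \<kappa>_def)
  define \<sigma> where "\<sigma> t = 1 + \<kappa> * (T0 + 1 - t)" for t
  have \<sigma>: "(\<sigma> has_real_derivative - \<kappa>) (at t)" for t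
    unfolding \<sigma>_def by (auto intro!: derivative_eq_intros)
  have pos: "supersolution (\<lambda>t. - h t) \<sigma> x T0 > 0" if "norm x \<le> R T0" for x
  proof -
    have "(norm x / R T0)\<^sup>2 \<le> 1" using relative_radius(1)[of T0 1 x] that by simp
    then have "\<sigma> T0 - (norm x / R T0)\<^sup>2 > 0" using \<kappa> by (simp add: \<sigma>_def)
    then show ?thesis using weight_pos by (simp add: barrier_def)
  qed
  \<comment> \<open>As \<open>\<sigma> T0 > 1\<close>, the barrier is positive on the closed ball,
    rim included. So the quotient is bounded, and \<open>M\<close> is its bound.\<close>
  have "continuous_on (cball 0 (R T0)) (\<lambda>x. \<psi> x T0 / supersolution (\<lambda>t. - h t) \<sigma> x T0)"
  proof (rule continuous_on_divide[OF solution_slice_continuous[OF order_refl]])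
    show "continuous_on (cball 0 (R T0)) (\<lambda>x. supersolution (\<lambda>t. - h t) \<sigma> x T0)"
      using slice_continuous[OF order_refl hm \<sigma>, of "\<lambda>p. p" 1] \<kappa> by (simp add: \<sigma>_def)
    show "\<forall>x\<in>cball 0 (R T0). supersolution (\<lambda>t. - h t) \<sigma> x T0 \<noteq> 0" using pos by fastforce
  qed
  then obtain M where M: "M > 0"
      "\<And>x. x \<in> cball 0 (R T0) \<Longrightarrow> \<psi> x T0 / supersolution (\<lambda>t. - h t) \<sigma> x T0 \<le> M"
    by (rule continuous_bounded_above_on_compact[OF compact_cball]) blast
  have T1: "\<psi> x (T0 + 1) \<le> M * supersolution (\<lambda>t. - h t) \<sigma> x (T0 + 1)" if "norm x \<le> R (T0 + 1)" for x
  proof (rule upper_step[where ?t0.0 = T0 and ?t1.0 = "T0 + 1" and ?\<sigma>1.0 = "- \<kappa>", OF _ _ hm \<sigma>])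
    show "1 \<le> \<sigma> t" if "T0 \<le> t" "t \<le> T0 + 1" for t using that \<kappa> by (simp add: \<sigma>_def)
    show "- (2 * n * D / (R t)\<^sup>2) \<le> - \<kappa>" if "T0 \<le> t" "t \<le> T0 + 1" for t
    proof -
      have R: "0 < R t" "R t \<le> Rm" using R_pos[of t] Rm(2)[of t] that by auto
      then have "(R t)\<^sup>2 \<le> Rm\<^sup>2" by (intro power_mono) auto
      then have "2 * n * D / Rm\<^sup>2 \<le> 2 * n * D / (R t)\<^sup>2"
        by (rule divide_left_mono) (use n_pos D_pos R Rm(1) in auto)
      then show ?thesis by (simp add: \<kappa>_def)
    qed
    show "\<psi> x T0 \<le> M * supersolution (\<lambda>t. - h t) \<sigma> x T0" if "norm x \<le> R T0" for x
      using M(2)[of x] pos[of x] that by (simp add: field_simps)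
  qed (use M(1) that h1_ge in auto)
  have "\<psi> x t \<le> M * (weight x t * (exp (h t) * (1 - (norm x / R t)\<^sup>2)))"
    if t: "T0 + 1 \<le> t" "norm x \<le> R t" for x t
  proof -
    \<comment> \<open>From now on the zero rests on the boundary. The two barriers agree at
      \<open>T0 + 1\<close> because \<sigma> equals \<open>1\<close> there, so the same
      \<open>M\<close> continues.\<close>
    have "\<psi> x t \<le> M * supersolution (\<lambda>t. - h t) (\<lambda>_. 1) x t"
    proof (rule upper_step[where ?t0.0 = "T0 + 1" and ?t1.0 = t and ?\<sigma>1.0 = 0, OF _ _ hm])
      show "\<psi> x (T0 + 1) \<le> M * supersolution (\<lambda>t. - h t) (\<lambda>_. 1) x (T0 + 1)"
        if "norm x \<le> R (T0 + 1)" for x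
        using T1[OF that] by (simp add: barrier_def \<sigma>_def)
    qed (use M(1) t h1_ge n_nonneg D_pos in auto)
    then show ?thesis by (simp add: barrier_def)
  qed
  then show ?thesis using M(1) by blast
qed

text \<open>On \<open>[T0, T0 + 1]\<close> the support of the barrier grows from a small ball to the whole ball.\<close>

lemma lower_bound:
  assumes "\<psi> 0 T0 > 0"
  shows "\<exists>\<epsilon>>0. \<forall>t\<ge>T0 + 1. \<forall>x. norm x \<le> R t \<longrightarrow>
     \<epsilon> * (weight x t * (exp (- h t) * (1 - (norm x / R t)\<^sup>2))) \<le> \<psi> x t"
proof -
  have RT0: "R T0 > 0" using R_pos by simp
  have "\<forall>x\<in>cball 0 (R T0). \<forall>e>0. \<exists>d>0. \<forall>x'\<in>cball 0 (R T0). dist x' x < d \<longrightarrow> dist (\<psi> x' T0) (\<psi> x T0) < e"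
    using solution_slice_continuous[OF order_refl] unfolding continuous_on_iff .
  from this[rule_format, of 0 "\<psi> 0 T0 / 2"] obtain d where d: "d > 0"
      "\<And>x. x \<in> cball 0 (R T0) \<Longrightarrow> dist x 0 < d \<Longrightarrow> dist (\<psi> x T0) (\<psi> 0 T0) < \<psi> 0 T0 / 2"
    using assms RT0 by auto
  define \<delta> where "\<delta> = min (d / 2) (R T0)"
  have \<delta>: "0 < \<delta>" "\<delta> < d" "\<delta> \<le> R T0" using d(1) RT0 by (auto simp: \<delta>_def)
  have near: "\<psi> 0 T0 / 2 \<le> \<psi> x T0" if "norm x \<le> \<delta>" for x
  proof -
    have "\<bar>\<psi> x T0 - \<psi> 0 T0\<bar> < \<psi> 0 T0 / 2"
      using d(2)[of x] that \<delta> by (simp add: dist_real_def)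
    then show ?thesis by linarith
  qed
  \<comment> \<open>Chosen so that \<open>sqrt \<sigma>0 * R T0 = \<delta>\<close>: the support
    starts as the ball on which \<psi> is at least half its value at the origin.\<close>
  define \<sigma>0 where "\<sigma>0 = (\<delta> / R T0)\<^sup>2"
  have s0: "0 < \<sigma>0" "\<sigma>0 \<le> 1" using \<delta> RT0 by (auto simp: \<sigma>0_def power_le_one)
  have sqrt0: "sqrt \<sigma>0 * R T0 = \<delta>" using \<delta> RT0 by (simp add: \<sigma>0_def)
  define \<sigma> where "\<sigma> t = \<sigma>0 + (1 - \<sigma>0) * (t - T0)" for t
  have \<sigma>: "(\<sigma> has_real_derivative 1 - \<sigma>0) (at t)" for t
    unfolding \<sigma>_def by (auto intro!: derivative_eq_intros)
  \<comment> \<open>The inequality for \<open>B\<close> in \<open>lower_step\<close> with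
    \<open>\<sigma>1 = 1 - \<sigma>0\<close>, multiplied by \<open>(R t)^2 / D\<close>; the summand
    \<open>3\<close> secures \<open>B t \<ge> 3\<close>.\<close>
  define B where "B t = 5 / 2 * ((R t)\<^sup>2 / D * (1 - \<sigma>0) + 2 * n + 8 * G t) + 3" for t
  have "continuous_on {T0..T0 + 1} (\<lambda>t. D / (R t)\<^sup>2 * (B t)^3 / (2 * \<sigma>0\<^sup>2))"
  proof -
    have "\<forall>t\<in>{T0..T0 + 1}. (R t)\<^sup>2 \<noteq> 0" using R_pos by fastforce
    moreover have "continuous_on {T0..T0 + 1} B"
      unfolding B_def by (intro continuous_intros cont_data order_refl) (use D_pos in auto)
    ultimately show ?thesis
      by (intro continuous_on_mult continuous_on_divide continuous_on_power
          continuous_on_const cont_data order_refl) (use s0 in auto)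
  qed
  then obtain l where l: "l > 0"
      "\<And>t. t \<in> {T0..T0 + 1} \<Longrightarrow> D / (R t)\<^sup>2 * (B t)^3 / (2 * \<sigma>0\<^sup>2) \<le> l"
    by (rule continuous_bounded_above_on_compact[OF compact_Icc]) blast
  \<comment> \<open>While the zero moves, \<open>B\<close> contains \<open>(R t)^2\<close> and the
    required rate is large. On a bounded time interval compactness bounds it by \<open>l\<close>,
    and the added term costs only the factor \<open>exp (- l)\<close> at \<open>T0 + 1\<close>,
    which \<open>\<epsilon>'\<close> takes over.\<close>
  define hl where "hl t = h t + l * (t - T0)" for t
  have hl: "(hl has_real_derivative h1 t + l) (at t)" if "T0 \<le> t" for t
    unfolding hl_def by (auto intro!: derivative_eq_intros h[OF that])
  have cont: "continuous_on {0..} (\<lambda>p. p + p * sqrt p)" by (intro continuous_intros)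
  have "continuous_on (cball 0 \<delta>) (\<lambda>x. subsolution hl \<sigma> x T0)"
    using slice_continuous[OF order_refl hl \<sigma> cont, of \<sigma>0] s0 by (simp add: \<sigma>_def sqrt0)
  then obtain N where N: "N > 0" "\<And>x. x \<in> cball 0 \<delta> \<Longrightarrow> subsolution hl \<sigma> x T0 \<le> N"
    by (rule continuous_bounded_above_on_compact[OF compact_cball]) blast
  define \<epsilon> where "\<epsilon> = \<psi> 0 T0 / 2 / N"
  have \<epsilon>: "\<epsilon> > 0" using assms N(1) by (simp add: \<epsilon>_def)
  have T1: "\<epsilon> * subsolution hl \<sigma> x (T0 + 1) \<le> \<psi> x (T0 + 1)" if x: "norm x \<le> R (T0 + 1)" for x
  proof (rule lower_step[where ?t0.0 = T0 and ?t1.0 = "T0 + 1" and ?\<sigma>1.0 = "1 - \<sigma>0" and ?\<sigma>0.0 = \<sigma>0 and B = B,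
        OF _ _ hl \<sigma>])
    show "\<sigma>0 \<le> \<sigma> t \<and> \<sigma> t \<le> 1" if "T0 \<le> t" "t \<le> T0 + 1" for t
    proof -
      have "0 \<le> (1 - \<sigma>0) * (t - T0)" using s0 that by simp
      moreover have "(1 - \<sigma>0) * (t - T0) \<le> (1 - \<sigma>0) * 1" using s0 that by (intro mult_left_mono) auto
      ultimately show ?thesis by (simp add: \<sigma>_def)
    qed
    show "3 \<le> B t \<and> 5 / 2 * (1 - \<sigma>0 + D / (R t)\<^sup>2 * (2 * n + 8 * G t)) \<le> D / (R t)\<^sup>2 * B t"
      if "T0 \<le> t" "t \<le> T0 + 1" for t
    proof
      show "3 \<le> B t" using G_nonneg[of t] n_nonneg D_pos s0 that by (simp add: B_def)
      have "D / (R t)\<^sup>2 * B t = 5 / 2 * (1 - \<sigma>0 + D / (R t)\<^sup>2 * (2 * n + 8 * G t)) + D / (R t)\<^sup>2 * 3"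
        using D_pos R_pos[of t] that by (simp add: B_def field_simps)
      then show "5 / 2 * (1 - \<sigma>0 + D / (R t)\<^sup>2 * (2 * n + 8 * G t)) \<le> D / (R t)\<^sup>2 * B t"
        using D_pos by simp
    qed
    show "D / (R t)\<^sup>2 * (B t)^3 / (2 * \<sigma>0\<^sup>2) \<le> h1 t + l" if "T0 \<le> t" "t \<le> T0 + 1" for t
      using l(2)[of t] h1_ge(1)[of t] that by simp
    show "\<epsilon> * subsolution hl \<sigma> x T0 \<le> \<psi> x T0" if "norm x \<le> sqrt (\<sigma> T0) * R T0" for x
    proof -
      have "norm x \<le> \<delta>" using that sqrt0 by (simp add: \<sigma>_def)
      then have "\<epsilon> * subsolution hl \<sigma> x T0 \<le> \<epsilon> * N" using N(2)[of x] \<epsilon> by (intro mult_left_mono) auto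
      also have "\<dots> = \<psi> 0 T0 / 2" using N(1) by (simp add: \<epsilon>_def)
      also have "\<dots> \<le> \<psi> x T0" using near \<open>norm x \<le> \<delta>\<close> .
      finally show ?thesis .
    qed
  qed (use s0 \<epsilon> x in \<open>auto simp: \<sigma>_def\<close>)
  define \<epsilon>' where "\<epsilon>' = \<epsilon> * exp (- l)"
  have \<epsilon>': "\<epsilon>' > 0" using \<epsilon> by (simp add: \<epsilon>'_def)
  have "\<epsilon>' * (weight x t * (exp (- h t) * (1 - (norm x / R t)\<^sup>2))) \<le> \<psi> x t"
    if t: "T0 + 1 \<le> t" "norm x \<le> R t" for x t
  proof -
    have "\<epsilon>' * subsolution h (\<lambda>_. 1) x t \<le> \<psi> x t"
    \<comment> \<open>With the zero at rest both \<sigma> and \<open>\<sigma>0\<close> are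
      \<open>1\<close>, and the required rate is exactly the hypothesis on
      \<open>h1\<close>.\<close>
    proof (rule lower_step[where ?t0.0 = "T0 + 1" and ?t1.0 = t and ?\<sigma>1.0 = 0 and ?\<sigma>0.0 = 1 and
          B = "\<lambda>t. 5 * n + 20 * G t + 3", OF _ _ h])
      show "3 \<le> 5 * n + 20 * G s + 3 \<and>
          5 / 2 * (0 + D / (R s)\<^sup>2 * (2 * n + 8 * G s)) \<le> D / (R s)\<^sup>2 * (5 * n + 20 * G s + 3)"
        if s: "T0 + 1 \<le> s" "s \<le> t" for s
      proof
        show "3 \<le> 5 * n + 20 * G s + 3" using G_nonneg[of s] n_nonneg s by simp
        have "D / (R s)\<^sup>2 * (5 * n + 20 * G s) \<le> D / (R s)\<^sup>2 * (5 * n + 20 * G s + 3)"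
          using D_pos by (intro mult_left_mono) auto
        then show "5 / 2 * (0 + D / (R s)\<^sup>2 * (2 * n + 8 * G s)) \<le> D / (R s)\<^sup>2 * (5 * n + 20 * G s + 3)"
          by (simp add: algebra_simps)
      qed
      show "\<epsilon>' * subsolution h (\<lambda>_. 1) x (T0 + 1) \<le> \<psi> x (T0 + 1)" if "norm x \<le> sqrt 1 * R (T0 + 1)" for x
        using T1[of x] that
        by (simp add: barrier_def \<sigma>_def hl_def \<epsilon>'_def exp_add exp_minus_inverse exp_diff exp_minus field_simps)
    qed (use t h1 \<epsilon>' in auto)
    \<comment> \<open>The profile \<open>m + m * sqrt m\<close> dominates \<open>m\<close>, so the
      correction is dropped at the end.\<close>
    moreover have "\<epsilon>' * (weight x t * (exp (- h t) * (1 - (norm x / R t)\<^sup>2))) \<le> \<epsilon>' * subsolution h (\<lambda>_. 1) x t"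
    proof -
      have "(norm x / R t)\<^sup>2 \<le> 1" using relative_radius(1)[of t 1 x] t by simp
      then show ?thesis unfolding barrier_def using \<epsilon>' weight_pos[of x t]
        by (intro mult_left_mono) auto
    qed
    ultimately show ?thesis by linarith
  qed
  then show ?thesis using \<epsilon>' by blast
qed

end

end

subsection \<open>Asymptotics for a critically growing radius\<close>

locale critical_radius =
  fixes D f0 cs \<alpha> :: real and R \<eta> \<eta>1 \<eta>2 \<eta>3 :: "real \<Rightarrow> real"
  assumes D_pos: "D > 0" and f0_pos: "f0 > 0" and \<alpha>_pos: "\<alpha> > 0" and cs: "cs = 2 * sqrt (D * f0)"
    and R_eq: "\<And>t. t \<ge> 0 \<Longrightarrow> R t = cs * t - \<alpha> * ln (t + 1) - \<eta> t"
    and \<eta>: "\<And>t. t \<ge> 0 \<Longrightarrow> (\<eta> has_real_derivative \<eta>1 t) (at t within {0..})"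
    and \<eta>1: "\<And>t. t \<ge> 0 \<Longrightarrow> (\<eta>1 has_real_derivative \<eta>2 t) (at t within {0..})"
    and \<eta>2: "\<And>t. t \<ge> 0 \<Longrightarrow> (\<eta>2 has_real_derivative \<eta>3 t) (at t within {0..})"
begin

lemma cs_pos: "cs > 0" using cs D_pos f0_pos by simp

lemma cs_sq: "cs\<^sup>2 = 4 * D * f0"
  using cs D_pos f0_pos by (simp add: power_mult_distrib)

definition R1 where "R1 t = cs - \<alpha> / (t + 1) - \<eta>1 t"
definition R2 where "R2 t = \<alpha> / (t + 1)\<^sup>2 - \<eta>2 t"

lemma at_within_pos: "t > 0 \<Longrightarrow> at t within {0..} = at (t::real)"
  by (rule at_within_interior) simp

lemma \<eta>_deriv: "t > 0 \<Longrightarrow> (\<eta> has_real_derivative \<eta>1 t) (at t)"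
  and \<eta>1_deriv: "t > 0 \<Longrightarrow> (\<eta>1 has_real_derivative \<eta>2 t) (at t)"
  and \<eta>2_deriv: "t > 0 \<Longrightarrow> (\<eta>2 has_real_derivative \<eta>3 t) (at t)"
  using \<eta>[of t] \<eta>1[of t] \<eta>2[of t] at_within_pos[of t] by auto

lemma R_deriv: assumes "t > 0" shows "(R has_real_derivative R1 t) (at t)"
proof -
  have formula: "((\<lambda>t. cs * t - \<alpha> * ln (t + 1) - \<eta> t) has_real_derivative R1 t) (at t)"
    unfolding R1_def using assms by (auto intro!: derivative_eq_intros \<eta>_deriv simp: divide_inverse)
  have "\<forall>\<^sub>F s in nhds t. s \<in> {0<..}" by (rule eventually_nhds_in_open) (use assms in auto)
  then have near: "\<forall>\<^sub>F s in nhds t. R s = cs * s - \<alpha> * ln (s + 1) - \<eta> s"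
    by eventually_elim (auto intro: R_eq)
  show ?thesis by (rule DERIV_cong_ev[OF refl near refl, THEN iffD2, OF formula])
qed

lemma R1_deriv: assumes "t > 0" shows "(R1 has_real_derivative R2 t) (at t)"
  unfolding R1_def R2_def
  using assms by (auto intro!: derivative_eq_intros \<eta>1_deriv simp: power2_eq_square)

lemma R2_cont: assumes "t > 0" shows "isCont R2 t"
  unfolding R2_def by (intro continuous_intros DERIV_isCont[OF \<eta>2_deriv[OF assms]]) (use assms in auto)

lemma R_cont: assumes "t > 0" shows "isCont R t"
  using R_deriv[OF assms] by (rule DERIV_isCont)

text \<open>The constant \<open>\<alpha> / 8\<close> is small enough that \<open>\<eta>2\<close>
  cannot reverse the sign of \<open>\<alpha> / (t + 1)^2\<close>, which is at least
  \<open>\<alpha> / 4 / t^2\<close> for \<open>t \<ge> 1\<close>. So \<open>R\<close> is eventually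
  convex, which will give \<open>G\<close> its sign. The free bound \<open>t1\<close> leaves room
  for a further requirement on the starting time.\<close>

lemma late_estimates:
  assumes "\<eta> \<in> O[at_top](\<lambda>_. 1)" "\<eta>1 \<in> o[at_top](\<lambda>t. 1 / t)" "\<eta>2 \<in> o[at_top](\<lambda>t. 1 / t ^ 2)"
  obtains T0 E where "T0 \<ge> 1" "T0 \<ge> t1" "E > 0"
    "\<And>t. t \<ge> T0 \<Longrightarrow> \<bar>\<eta> t\<bar> \<le> E" "\<And>t. t \<ge> T0 \<Longrightarrow> \<bar>\<eta>1 t\<bar> \<le> 1 / t"
    "\<And>t. t \<ge> T0 \<Longrightarrow> \<bar>\<eta>2 t\<bar> \<le> \<alpha> / 8 / t\<^sup>2" "\<And>t. t \<ge> T0 \<Longrightarrow> cs / 2 * (t + 1) \<le> R t"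
proof -
  obtain E where E: "E > 0" "\<forall>\<^sub>F t in at_top. \<bar>\<eta> t\<bar> \<le> E"
    using landau_o.bigE[OF assms(1)] by auto
  have 1: "\<forall>\<^sub>F t in at_top. \<bar>\<eta>1 t\<bar> \<le> 1 * \<bar>1 / t\<bar>"
    using landau_o.smallD[OF assms(2), of 1] by simp
  have 2: "\<forall>\<^sub>F t in at_top. \<bar>\<eta>2 t\<bar> \<le> \<alpha> / 8 * \<bar>1 / t\<^sup>2\<bar>"
    using landau_o.smallD[OF assms(3), of "\<alpha> / 8"] \<alpha>_pos by simp
  have 3: "\<forall>\<^sub>F t in at_top. \<alpha> * ln (t + 1) + E + cs / 2 \<le> cs / 2 * t"
    using cs_pos \<alpha>_pos by real_asymp
  have "\<forall>\<^sub>F t in at_top. \<bar>\<eta> t\<bar> \<le> E \<and> \<bar>\<eta>1 t\<bar> \<le> 1 / t \<and> \<bar>\<eta>2 t\<bar> \<le> \<alpha> / 8 / t\<^sup>2 \<and> cs / 2 * (t + 1) \<le> R t"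
    using E(2) 1 2 3 eventually_ge_at_top[of 1]
  proof eventually_elim
    case (elim t)
    have "cs / 2 * (t + 1) \<le> R t" using elim R_eq[of t] by (simp add: algebra_simps)
    then show ?case using elim by simp
  qed
  then obtain T where T: "\<And>t. t \<ge> T \<Longrightarrow> \<bar>\<eta> t\<bar> \<le> E \<and> \<bar>\<eta>1 t\<bar> \<le> 1 / t \<and> \<bar>\<eta>2 t\<bar> \<le> \<alpha> / 8 / t\<^sup>2 \<and>
      cs / 2 * (t + 1) \<le> R t"
    unfolding eventually_at_top_linorder by blast
  show thesis
    by (rule that[of "max T (max 1 t1)" E]) (use E(1) T in auto)
qed

end

section \<open>Bounds on the radius, on G and on the exponent at late times\<close>

locale late_critical_radius = critical_radius +
  fixes T0 E :: real
  assumes T0: "T0 \<ge> 1" and E: "E > 0"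
    and \<eta>_le: "\<And>t. t \<ge> T0 \<Longrightarrow> \<bar>\<eta> t\<bar> \<le> E"
    and \<eta>1_le: "\<And>t. t \<ge> T0 \<Longrightarrow> \<bar>\<eta>1 t\<bar> \<le> 1 / t"
    and \<eta>2_le: "\<And>t. t \<ge> T0 \<Longrightarrow> \<bar>\<eta>2 t\<bar> \<le> \<alpha> / 8 / t\<^sup>2"
    and R_ge: "\<And>t. t \<ge> T0 \<Longrightarrow> cs / 2 * (t + 1) \<le> R t"
begin

lemma R_pos: assumes "t \<ge> T0" shows "R t > 0"
proof -
  have "0 < cs / 2 * (t + 1)" using cs_pos assms T0 by simp
  then show ?thesis using R_ge[OF assms] by linarith
qed

lemma R_le: assumes "t \<ge> T0" shows "R t \<le> (cs + E) * (t + 1)"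
proof -
  have "0 \<le> \<alpha> * ln (t + 1)" using \<alpha>_pos assms T0 by simp
  moreover have "E \<le> E * (t + 1)" using E assms T0 by simp
  moreover have "(cs + E) * (t + 1) = cs * t + cs + E * (t + 1)" by (simp add: algebra_simps)
  moreover have "R t = cs * t - \<alpha> * ln (t + 1) - \<eta> t" using R_eq assms T0 by simp
  ultimately show ?thesis using \<eta>_le[OF assms] cs_pos by linarith
qed

lemma R1_le: assumes "t \<ge> T0" shows "\<bar>R1 t\<bar> \<le> cs + \<alpha> + 1"
proof -
  have "\<alpha> / (t + 1) \<le> \<alpha> / 1"
    by (rule divide_left_mono) (use \<alpha>_pos assms T0 in auto)
  moreover have "0 \<le> \<alpha> / (t + 1)" "1 / t \<le> 1" using \<alpha>_pos assms T0 by auto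
  ultimately show ?thesis using \<eta>1_le[OF assms] cs_pos by (simp add: R1_def)
qed

lemma R2_bounds: assumes "t \<ge> T0" shows "0 \<le> R2 t" "R2 t \<le> 2 * \<alpha> / t\<^sup>2"
proof -
  have t: "t \<ge> 1" using assms T0 by simp
  have "(t + 1)\<^sup>2 \<le> (2 * t)\<^sup>2" using t by (intro power_mono) auto
  then have "\<alpha> / (2 * t)\<^sup>2 \<le> \<alpha> / (t + 1)\<^sup>2" using \<alpha>_pos t by (intro divide_left_mono) auto
  moreover have "\<alpha> / (2 * t)\<^sup>2 = \<alpha> / 4 / t\<^sup>2" by (simp add: power_mult_distrib)
  moreover have "0 \<le> \<alpha> / t\<^sup>2" using \<alpha>_pos by simp
  ultimately show "0 \<le> R2 t" using \<eta>2_le[OF assms] by (simp add: R2_def)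
  have "t\<^sup>2 \<le> (t + 1)\<^sup>2" using t by (intro power_mono) auto
  then have "\<alpha> / (t + 1)\<^sup>2 \<le> \<alpha> / t\<^sup>2" using \<alpha>_pos t by (intro divide_left_mono) auto
  then show "R2 t \<le> 2 * \<alpha> / t\<^sup>2" using \<eta>2_le[OF assms] \<open>0 \<le> \<alpha> / t\<^sup>2\<close> by (simp add: R2_def)
qed

text \<open>The integral starts at \<open>T0 / 2\<close> so that \<open>T0\<close> is an interior
  point and the derivative there is two-sided. The subtracted constant normalises
  \<open>G T0 = 0\<close>.\<close>

definition G where
  "G t = integral {T0 / 2..t} (\<lambda>s. R s * R2 s / (4 * D)) - integral {T0 / 2..T0} (\<lambda>s. R s * R2 s / (4 * D))"

lemma G_deriv: assumes "t \<ge> T0" shows "(G has_real_derivative R t * R2 t / (4 * D)) (at t)"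
proof -
  have "continuous_on {T0 / 2..t + 1} (\<lambda>s. R s * R2 s / (4 * D))"
    using T0 D_pos R_cont R2_cont by (intro continuous_at_imp_continuous_on continuous_intros) auto
  then have "((\<lambda>t. integral {T0 / 2..t} (\<lambda>s. R s * R2 s / (4 * D))) has_real_derivative R t * R2 t / (4 * D))
      (at t within {T0 / 2..t + 1})"
    by (rule integral_has_real_derivative) (use assms T0 in auto)
  moreover have "at t within {T0 / 2..t + 1} = at t"
    using assms T0 by (intro at_within_interior) (auto simp: interior_atLeastAtMost_real)
  ultimately have "((\<lambda>t. integral {T0 / 2..t} (\<lambda>s. R s * R2 s / (4 * D))) has_real_derivative
      R t * R2 t / (4 * D)) (at t)" by (simp only:)
  from DERIV_diff[OF this DERIV_const] show ?thesis unfolding G_def diff_0_right .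
qed

lemma G_nonneg: assumes "t \<ge> T0" shows "G t \<ge> 0"
proof -
  have "G T0 \<le> G t"
  proof (rule DERIV_nonneg_imp_nondecreasing[OF assms])
    fix s assume "T0 \<le> s" "s \<le> t"
    then show "\<exists>y. (G has_real_derivative y) (at s) \<and> 0 \<le> y"
      using G_deriv[of s] R_pos[of s] R2_bounds(1)[of s] D_pos
      by (intro exI[of _ "R s * R2 s / (4 * D)"]) auto
  qed
  then show ?thesis by (simp add: G_def)
qed

text \<open>\<open>K / s\<close> bounds the derivative of \<open>G\<close>, by
  \<open>R s \<le> (cs + E) * (2 * s)\<close> and
  \<open>R2 s \<le> 2 * \<alpha> / s^2\<close>.\<close>

definition K where "K = (cs + E) * \<alpha> / D"

lemma K_pos: "K > 0" using cs_pos E \<alpha>_pos D_pos by (simp add: K_def)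

text \<open>A derivative of at most \<open>K / s\<close> means logarithmic growth, for which a small
  power is a convenient substitute. With the exponent \<open>1 / 6\<close> the cube of
  \<open>G\<close> is bounded by a multiple of \<open>t powr (1 / 2)\<close>, still integrable after
  division by \<open>(R t)^2\<close>.\<close>

lemma G_le: assumes "t \<ge> T0" shows "G t \<le> 6 * K * t powr (1 / 6)"
proof -
  have "6 * K * T0 powr (1 / 6) - G T0 \<le> 6 * K * t powr (1 / 6) - G t"
  proof (rule DERIV_nonneg_imp_nondecreasing[OF assms])
    fix s assume s: "T0 \<le> s" "s \<le> t"
    then have s1: "s \<ge> 1" using T0 by simp
    have "R s * R2 s \<le> ((cs + E) * (2 * s)) * (2 * \<alpha> / s\<^sup>2)"
    proof (rule mult_mono)
      have "(cs + E) * (s + 1) \<le> (cs + E) * (2 * s)" using s1 cs_pos E by (intro mult_left_mono) auto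
      then show "R s \<le> (cs + E) * (2 * s)" using R_le[OF s(1)] by linarith
    qed (use R2_bounds[OF s(1)] s1 cs_pos E in auto)
    also have "\<dots> = 4 * D * (K / s)" using s1 D_pos by (simp add: K_def field_simps power2_eq_square)
    finally have "R s * R2 s / (4 * D) \<le> K / s" using D_pos by (simp add: field_simps)
    also have "K / s = K * s powr (- 1)" using s1 by (simp add: powr_minus divide_inverse)
    also have "\<dots> \<le> K * s powr (1 / 6 - 1)" using s1 K_pos by (intro mult_left_mono powr_mono) auto
    finally have le: "0 \<le> K * s powr (1 / 6 - 1) - R s * R2 s / (4 * D)" by simp
    have "((\<lambda>t. 6 * K * t powr (1 / 6)) has_real_derivative 6 * K * (1 / 6 * s powr (1 / 6 - 1))) (at s)"
      using s1 by (intro DERIV_cmult has_real_derivative_powr) auto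
    from DERIV_diff[OF this G_deriv[OF s(1)]] le
    show "\<exists>y. ((\<lambda>t. 6 * K * t powr (1 / 6) - G t) has_real_derivative y) (at s) \<and> 0 \<le> y"
      by (intro exI conjI) auto
  qed
  moreover have "G T0 = 0" by (simp add: G_def)
  moreover have "0 \<le> 6 * K * T0 powr (1 / 6)" using K_pos by simp
  ultimately show ?thesis by linarith
qed

text \<open>The cube contributes \<open>t powr (1 / 2)\<close> and \<open>1 / (R t)^2\<close>
  contributes \<open>t powr (- 2)\<close>. The resulting exponent lies below \<open>- 1\<close>, so
  the rate has a bounded antiderivative. The summand \<open>120 * K\<close> of \<open>b\<close> is
  \<open>20\<close> times the constant in \<open>G_le\<close>.\<close>

lemma decay_rate:
  assumes "n \<ge> 0"
  obtains k where "k > 0"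
    "\<And>t. t \<ge> T0 \<Longrightarrow> D / (R t)\<^sup>2 * (5 * n + 20 * G t + 3)^3 / 2 \<le> k * t powr (- 3 / 2)"
proof -
  define b where "b = 5 * n + 3 + 120 * K"
  have b: "b > 0" using assms K_pos by (simp add: b_def)
  define k where "k = 2 * D * b^3 / cs\<^sup>2"
  have "D / (R t)\<^sup>2 * (5 * n + 20 * G t + 3)^3 / 2 \<le> k * t powr (- 3 / 2)" if t: "t \<ge> T0" for t
  proof -
    have t1: "t \<ge> 1" using t T0 by simp
    define p where "p = t powr (1 / 6)"
    have p: "p \<ge> 1" unfolding p_def using t1 by (intro ge_one_powr_ge_zero) auto
    have "5 * n + 3 \<le> (5 * n + 3) * p" using p assms by (intro mult_le_cancel_left1[THEN iffD2]) auto
    then have "5 * n + 20 * G t + 3 \<le> b * p"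
      using G_le[OF t] by (simp add: b_def p_def algebra_simps)
    then have "(5 * n + 20 * G t + 3)^3 \<le> (b * p)^3"
      using G_nonneg[OF t] assms by (intro power_mono) auto
    also have "(b * p)^3 = b^3 * t powr (1 / 2)"
    proof -
      have "p^3 = t powr (1 / 2)" using t1 unfolding p_def by (simp add: powr_power)
      then show ?thesis by (simp add: power_mult_distrib)
    qed
    finally have 1: "(5 * n + 20 * G t + 3)^3 \<le> b^3 * t powr (1 / 2)" .
    have "cs / 2 * t \<le> R t" using R_ge[OF t] cs_pos by (simp add: algebra_simps)
    then have "(cs / 2 * t)\<^sup>2 \<le> (R t)\<^sup>2" using cs_pos t1 by (intro power_mono) auto
    moreover have "0 < (cs / 2 * t)\<^sup>2" using cs_pos t1 by simp
    ultimately have "D / (R t)\<^sup>2 \<le> D / (cs / 2 * t)\<^sup>2"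
      using D_pos R_pos[OF t] by (intro divide_left_mono) auto
    then have "D / (R t)\<^sup>2 * (5 * n + 20 * G t + 3)^3 \<le> D / (cs / 2 * t)\<^sup>2 * (b^3 * t powr (1 / 2))"
      using 1 G_nonneg[OF t] assms D_pos by (intro mult_mono) auto
    also have "\<dots> = 2 * k * (t powr (1 / 2) / t\<^sup>2)"
      using cs_pos t1 by (simp add: k_def power_mult_distrib field_simps)
    also have "t powr (1 / 2) / t\<^sup>2 = t powr (1 / 2 - 2)"
      using t1 by (simp only: powr_diff powr_numeral)
    finally show ?thesis by simp
  qed
  moreover have "k > 0" using b D_pos cs_pos by (simp add: k_def)
  ultimately show thesis by (rule that[rotated])
qed

text \<open>\<eta> is bounded, but for \<open>\<eta>1\<close> only the bound \<open>1 / t\<close> is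
  available, which is not integrable; so \<open>cs / (2 * D) * \<eta> t\<close> is split off
  undifferentiated. Since \<open>cs^2 = 4 * D * f0\<close>, the derivative of the rest
  \<open>S\<close> is exactly \<open>- q t\<close>, minus a square of order
  \<open>1 / t^2\<close>.\<close>

lemma exponent_bounded:
  obtains C where "\<And>t. t \<ge> T0 \<Longrightarrow>
    \<bar>f0 * t + G t - R t * R1 t / (4 * D) - \<alpha> * cs / (2 * D) * ln (t + 1)\<bar> \<le> C"
proof -
  define S where "S t = f0 * t + G t - R t * R1 t / (4 * D) - \<alpha> * cs / (2 * D) * ln (t + 1) -
    cs / (2 * D) * \<eta> t" for t
  define P where "P = (\<alpha> + 1)\<^sup>2 / (4 * D)"
  define q where "q t = (\<alpha> / (t + 1) + \<eta>1 t)\<^sup>2 / (4 * D)" for t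
  have S: "(S has_real_derivative - q t) (at t)" if t: "t \<ge> T0" for t
  proof -
    have t1: "t \<ge> 1" using t T0 by simp
    have "(S has_real_derivative f0 * 1 + R t * R2 t / (4 * D) - (R1 t * R1 t + R2 t * R t) / (4 * D) -
        \<alpha> * cs / (2 * D) * (1 / (t + 1)) - cs / (2 * D) * \<eta>1 t) (at t)"
      unfolding S_def
      by (intro DERIV_diff DERIV_add DERIV_cmult DERIV_ident DERIV_cdivide DERIV_mult G_deriv
          R_deriv R1_deriv \<eta>_deriv t) (use t1 in \<open>auto intro!: derivative_eq_intros\<close>)
    moreover have "f0 * 1 + R t * R2 t / (4 * D) - (R1 t * R1 t + R2 t * R t) / (4 * D) -
        \<alpha> * cs / (2 * D) * (1 / (t + 1)) - cs / (2 * D) * \<eta>1 t = - q t"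
    proof -
      define p where "p = \<alpha> / (t + 1)"
      have f0: "f0 = cs\<^sup>2 / (4 * D)" using cs_sq D_pos by simp
      have e: "\<alpha> * cs / (2 * D) * (1 / (t + 1)) = cs / (2 * D) * p" by (simp add: p_def)
      show ?thesis
        unfolding e q_def R1_def p_def[symmetric] f0 using D_pos
        by (simp add: field_simps power2_eq_square)
    qed
    ultimately show ?thesis by simp
  qed
  have q: "0 \<le> q t" "q t \<le> P / t\<^sup>2" if t: "t \<ge> T0" for t
  proof -
    have t1: "t \<ge> 1" using t T0 by simp
    show "0 \<le> q t" using D_pos by (simp add: q_def)
    have "\<bar>\<alpha> / (t + 1) + \<eta>1 t\<bar> \<le> \<alpha> / (t + 1) + 1 / t"
    proof -
      have "0 \<le> \<alpha> / (t + 1)" using \<alpha>_pos t1 by simp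
      then show ?thesis using \<eta>1_le[OF t] by linarith
    qed
    also have "\<alpha> / (t + 1) \<le> \<alpha> / t" using \<alpha>_pos t1 by (intro divide_left_mono) auto
    finally have "\<bar>\<alpha> / (t + 1) + \<eta>1 t\<bar> \<le> (\<alpha> + 1) / t" by (simp add: add_divide_distrib)
    then have "\<bar>\<alpha> / (t + 1) + \<eta>1 t\<bar>\<^sup>2 \<le> ((\<alpha> + 1) / t)\<^sup>2" by (intro power_mono) auto
    then have "q t \<le> ((\<alpha> + 1) / t)\<^sup>2 / (4 * D)"
      unfolding q_def using D_pos by (simp add: divide_right_mono)
    then show "q t \<le> P / t\<^sup>2" by (simp add: P_def power_divide mult.commute)
  qed
  have P: "P \<ge> 0" using D_pos by (simp add: P_def)
  have Sb: "\<bar>S t\<bar> \<le> \<bar>S T0\<bar> + P" if t: "t \<ge> T0" for t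
  proof -
    have "S t \<le> S T0"
    proof (rule DERIV_nonpos_imp_nonincreasing[OF t])
      fix s assume "T0 \<le> s" "s \<le> t"
      then show "\<exists>y. (S has_real_derivative y) (at s) \<and> y \<le> 0"
        using S[of s] q(1)[of s] by (intro exI conjI) auto
    qed
    \<comment> \<open>\<open>S\<close> decreases, but only by a bounded amount: the derivative
      \<open>P / t^2\<close> of \<open>- P / t\<close> outweighs \<open>q t\<close>, so
      \<open>S t - P / t\<close> increases.\<close>
    moreover have "S T0 - P / T0 \<le> S t - P / t"
    proof (rule DERIV_nonneg_imp_nondecreasing[OF t])
      fix s assume s: "T0 \<le> s" "s \<le> t"
      have "((\<lambda>t. P / t) has_real_derivative - (P / s\<^sup>2)) (at s)"
        using s T0 by (auto intro!: derivative_eq_intros simp: power2_eq_square)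
      from DERIV_diff[OF S[OF s(1)] this] q(2)[OF s(1)]
      show "\<exists>y. ((\<lambda>t. S t - P / t) has_real_derivative y) (at s) \<and> 0 \<le> y"
        by (intro exI conjI) auto
    qed
    moreover have "P / T0 \<le> P" using divide_left_mono[OF T0 P] T0 by simp
    moreover have "0 \<le> P / t" using P t T0 by simp
    ultimately show ?thesis by linarith
  qed
  have "\<bar>f0 * t + G t - R t * R1 t / (4 * D) - \<alpha> * cs / (2 * D) * ln (t + 1)\<bar> \<le>
      \<bar>S T0\<bar> + P + cs / (2 * D) * E" if t: "t \<ge> T0" for t
  proof -
    have "\<bar>cs / (2 * D) * \<eta> t\<bar> \<le> cs / (2 * D) * E"
      using \<eta>_le[OF t] cs_pos D_pos by (simp add: abs_mult divide_right_mono mult_left_mono)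
    moreover have "f0 * t + G t - R t * R1 t / (4 * D) - \<alpha> * cs / (2 * D) * ln (t + 1) =
        S t + cs / (2 * D) * \<eta> t" by (simp add: S_def)
    ultimately show ?thesis using Sb[OF t] by linarith
  qed
  then show thesis by (rule that)
qed

end

section \<open>From the weight to the power of t + 1\<close>

context late_critical_radius
begin

text \<open>Here \<open>y = O(1)\<close> enters. The coefficient of \<open>(norm x)^2\<close> in the
  exponent is of order \<open>1 / R t\<close>, while
  \<open>(R t)^2 - (norm x)^2 \<le> 2 * Y * R t\<close>, so moving inwards by at most
  \<open>Y\<close> changes the exponent by a bounded amount.\<close>

lemma weight_estimate:
  assumes "Y > 0"
  obtains C where "\<And>(x::'a::euclidean_space) t. t \<ge> T0 \<Longrightarrow> norm x \<le> R t \<Longrightarrow> R t - norm x \<le> Y \<Longrightarrow>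
    exp (- C) * (t + 1) powr (\<alpha> * cs / (2 * D) - real DIM('a) / 2) \<le> barrier_weight D f0 R R1 G x t \<and>
    barrier_weight D f0 R R1 G x t \<le> exp C * (t + 1) powr (\<alpha> * cs / (2 * D) - real DIM('a) / 2)"
proof -
  define n where "n = real DIM('a)"
  define p where "p = \<alpha> * cs / (2 * D) - n / 2"
  obtain C1 where C1: "\<And>t. t \<ge> T0 \<Longrightarrow>
      \<bar>f0 * t + G t - R t * R1 t / (4 * D) - \<alpha> * cs / (2 * D) * ln (t + 1)\<bar> \<le> C1"
    using exponent_bounded by blast
  define C2 where "C2 = \<bar>ln (cs / 2)\<bar> + \<bar>ln (cs + E)\<bar>"
  define C3 where "C3 = 12 * K / cs + (cs + \<alpha> + 1) / (4 * D)"
  define C where "C = C1 + n / 2 * C2 + C3 * (2 * Y)"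
  have "exp (- C) * (t + 1) powr p \<le> barrier_weight D f0 R R1 G x t \<and>
      barrier_weight D f0 R R1 G x t \<le> exp C * (t + 1) powr p"
    if t: "t \<ge> T0" and x: "norm x \<le> R t" "R t - norm x \<le> Y" for x :: 'a and t
  proof -
    have t1: "t \<ge> 1" using t T0 by simp
    have R: "R t > 0" using R_pos[OF t] .
    define L where "L = f0 * t - n / 2 * ln (R t) + (G t / (R t)\<^sup>2 - R1 t / (4 * D * R t)) * (norm x)\<^sup>2"
    define g where "g = G t / (R t)\<^sup>2 - R1 t / (4 * D * R t)"
    have gR: "g * (R t)\<^sup>2 = G t - R t * R1 t / (4 * D)"
      using R D_pos by (simp add: g_def field_simps power2_eq_square)
    \<comment> \<open>Three bounded parts: the exponent on the boundary, the power of
      \<open>R t\<close> against that of \<open>t + 1\<close>, and the shift inwards.\<close>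
    have split: "L - p * ln (t + 1) =
        (f0 * t + G t - R t * R1 t / (4 * D) - \<alpha> * cs / (2 * D) * ln (t + 1)) -
        n / 2 * (ln (R t) - ln (t + 1)) - g * ((R t)\<^sup>2 - (norm x)\<^sup>2)"
    proof -
      have "L = f0 * t - n / 2 * ln (R t) + g * (norm x)\<^sup>2" by (simp add: L_def g_def)
      then show ?thesis using gR by (simp add: p_def algebra_simps)
    qed
    have b2: "\<bar>n / 2 * (ln (R t) - ln (t + 1))\<bar> \<le> n / 2 * C2"
    proof -
      have "ln (cs / 2 * (t + 1)) \<le> ln (R t)" "ln (R t) \<le> ln ((cs + E) * (t + 1))"
        using R_ge[OF t] R_le[OF t] R cs_pos E t1 by simp_all
      moreover have "ln (cs / 2 * (t + 1)) = ln (cs / 2) + ln (t + 1)"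
        using cs_pos t1 by (intro ln_mult_pos) auto
      moreover have "ln ((cs + E) * (t + 1)) = ln (cs + E) + ln (t + 1)"
        using cs_pos E t1 by (intro ln_mult_pos) auto
      ultimately have "\<bar>ln (R t) - ln (t + 1)\<bar> \<le> C2" unfolding C2_def by linarith
      then have "n / 2 * \<bar>ln (R t) - ln (t + 1)\<bar> \<le> n / 2 * C2"
        by (rule mult_left_mono) (simp add: n_def)
      then show ?thesis by (simp add: abs_mult n_def)
    qed
    have b3: "\<bar>g * ((R t)\<^sup>2 - (norm x)\<^sup>2)\<bar> \<le> C3 * (2 * Y)"
    proof -
      have "G t / R t \<le> 12 * K / cs"
      proof -
        have "t powr (1 / 6) \<le> t powr 1" using t1 by (intro powr_mono) auto
        then have "t powr (1 / 6) \<le> t + 1" using t1 by simp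
        then have "6 * K * t powr (1 / 6) \<le> 6 * K * (t + 1)" using K_pos by simp
        then have "G t \<le> 6 * K * (t + 1)" using G_le[OF t] by linarith
        also have "\<dots> = 12 * K / cs * (cs / 2 * (t + 1))" using cs_pos by (simp add: field_simps)
        also have "\<dots> \<le> 12 * K / cs * R t"
          using R_ge[OF t] by (rule mult_left_mono) (use K_pos cs_pos in simp)
        finally show ?thesis using R by (simp only: pos_divide_le_eq)
      qed
      moreover have "0 \<le> G t / R t" using G_nonneg[OF t] R by simp
      moreover have "\<bar>R1 t / (4 * D)\<bar> \<le> (cs + \<alpha> + 1) / (4 * D)"
        using R1_le[OF t] D_pos by (simp add: divide_right_mono)
      moreover have "g * R t = G t / R t - R1 t / (4 * D)"
        using R D_pos by (simp add: g_def field_simps power2_eq_square)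
      ultimately have gR': "\<bar>g * R t\<bar> \<le> C3" unfolding C3_def by linarith
      have "\<bar>(R t)\<^sup>2 - (norm x)\<^sup>2\<bar> \<le> R t * (2 * Y)"
      proof -
        have "(R t)\<^sup>2 - (norm x)\<^sup>2 = (R t + norm x) * (R t - norm x)"
          by (simp add: power2_eq_square algebra_simps)
        moreover have "(R t + norm x) * (R t - norm x) \<le> (2 * R t) * Y"
          using x R by (intro mult_mono) auto
        moreover have "0 \<le> (R t + norm x) * (R t - norm x)" using x R by simp
        ultimately show ?thesis by simp
      qed
      then have "\<bar>g * ((R t)\<^sup>2 - (norm x)\<^sup>2)\<bar> \<le> \<bar>g\<bar> * (R t * (2 * Y))"
        unfolding abs_mult by (rule mult_left_mono) simp
      also have "\<dots> = \<bar>g * R t\<bar> * (2 * Y)" using R by (simp add: abs_mult)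
      also have "\<bar>g * R t\<bar> * (2 * Y) \<le> C3 * (2 * Y)"
        using gR' by (rule mult_right_mono) (use assms in simp)
      finally show ?thesis .
    qed
    have "\<bar>L - p * ln (t + 1)\<bar> \<le> C"
      unfolding split C_def using C1[OF t] b2 b3 by linarith
    then have bounds: "- C + p * ln (t + 1) \<le> L" "L \<le> C + p * ln (t + 1)" by linarith+
    have "barrier_weight D f0 R R1 G x t = exp L" by (simp add: barrier_weight_def L_def n_def)
    moreover have "exp (c + p * ln (t + 1)) = exp c * (t + 1) powr p" for c
      using t1 by (simp add: powr_def exp_add)
    ultimately show ?thesis using bounds by (metis exp_le_cancel_iff)
  qed
  then show thesis unfolding p_def n_def by (rule that)
qed

text \<open>With \<open>y = R t - norm x\<close> the difference factors as \<open>y / R t\<close>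
  times \<open>(R t + norm x) / R t\<close>, and the second factor lies between \<open>1\<close> and
  \<open>2\<close>. The division by \<open>R t\<close> supplies the \<open>- 1\<close> in the final
  exponent.\<close>

lemma boundary_distance:
  fixes x :: "'a::real_normed_vector"
  assumes t: "t \<ge> T0" and x: "norm x \<le> R t"
  shows "(R t - norm x) / ((cs + E) * (t + 1)) \<le> 1 - (norm x / R t)\<^sup>2"
    and "1 - (norm x / R t)\<^sup>2 \<le> 4 / cs * (R t - norm x) / (t + 1)"
proof -
  have t1: "t \<ge> 1" using t T0 by simp
  have R: "R t > 0" using R_pos[OF t] .
  define y where "y = R t - norm x"
  have y: "0 \<le> y" using x by (simp add: y_def)
  have eq: "1 - (norm x / R t)\<^sup>2 = y / R t * ((R t + norm x) / R t)"
    using R by (simp add: y_def field_simps power2_eq_square)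
  have q: "1 \<le> (R t + norm x) / R t" "(R t + norm x) / R t \<le> 2" using R x by (simp_all add: field_simps)
  have yR: "0 \<le> y / R t" using y R by simp
  have "y / ((cs + E) * (t + 1)) \<le> y / R t"
    using R_le[OF t] y by (rule divide_left_mono) (use R cs_pos E t1 in auto)
  also have "\<dots> \<le> y / R t * ((R t + norm x) / R t)" using mult_left_mono[OF q(1) yR] by simp
  finally show "(R t - norm x) / ((cs + E) * (t + 1)) \<le> 1 - (norm x / R t)\<^sup>2"
    unfolding eq y_def .
  have "y / R t * ((R t + norm x) / R t) \<le> y / R t * 2" using q(2) yR by (rule mult_left_mono)
  also have "\<dots> \<le> y / (cs / 2 * (t + 1)) * 2"
  proof (rule mult_right_mono)
    show "y / R t \<le> y / (cs / 2 * (t + 1))"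
      using R_ge[OF t] y by (rule divide_left_mono) (use R cs_pos t1 in auto)
  qed simp
  also have "\<dots> = 4 / cs * y / (t + 1)" using cs_pos t1 by (simp add: field_simps)
  finally show "1 - (norm x / R t)\<^sup>2 \<le> 4 / cs * (R t - norm x) / (t + 1)"
    unfolding eq y_def .
qed

lemma solution_estimate:
  fixes \<psi> :: "'a::euclidean_space \<Rightarrow> real \<Rightarrow> real"
  defines "p \<equiv> - 1 - real DIM('a) / 2 + \<alpha> * cs / (2 * D)"
  assumes sol: "moving_ball_solution D f0 R \<psi>"
    and nonneg: "\<And>x t. t > 0 \<Longrightarrow> norm x \<le> R t \<Longrightarrow> \<psi> x t \<ge> 0"
    and pos: "\<psi> 0 T0 > 0" and "Y > 0"
  shows "\<exists>\<beta>0 \<beta>1. 0 < \<beta>0 \<and> \<beta>0 \<le> \<beta>1 \<and>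
    (\<forall>t\<ge>T0 + 1. \<forall>x. 0 \<le> R t - norm x \<and> R t - norm x \<le> Y \<longrightarrow>
      \<beta>0 * (R t - norm x) * (t + 1) powr p \<le> \<psi> x t \<and> \<psi> x t \<le> \<beta>1 * (R t - norm x) * (t + 1) powr p)"
proof -
  interpret W: moving_ball_weights D f0 T0 R R1 R2 G \<psi>
  proof
    show "T0 > 0" using T0 by simp
    show "(R has_real_derivative R1 t) (at t)" "(R1 has_real_derivative R2 t) (at t)" if "T0 \<le> t" for t
      using that T0 by (auto intro!: R_deriv R1_deriv)
  qed (use D_pos R_pos G_deriv G_nonneg sol nonneg in auto)
  obtain k where k: "k > 0"
      "\<And>t. t \<ge> T0 \<Longrightarrow> D / (R t)\<^sup>2 * (5 * W.n + 20 * G t + 3)^3 / 2 \<le> k * t powr (- 3 / 2)"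
    using decay_rate[OF W.n_nonneg] by blast
  \<comment> \<open>The antiderivative that tends to \<open>0\<close>. It is nonpositive, hence
    \<open>exp (h t) \<le> 1 \<le> exp (- h t)\<close>, and both factors drop out of the
    estimates.\<close>
  define h where "h t = - 2 * k * t powr (- 1 / 2)" for t
  have h: "(h has_real_derivative k * t powr (- 3 / 2)) (at t)" if "T0 \<le> t" for t
  proof -
    have "((\<lambda>t. - 2 * k * t powr (- 1 / 2)) has_real_derivative
        - 2 * k * (- 1 / 2 * t powr (- 1 / 2 - 1))) (at t)"
      using that T0 by (intro DERIV_cmult has_real_derivative_powr) auto
    then show ?thesis unfolding h_def by simp
  qed
  have h_nonpos: "h t \<le> 0" for t using k(1) by (simp add: h_def)
  obtain M where M: "M > 0" "\<And>t x. t \<ge> T0 + 1 \<Longrightarrow> norm x \<le> R t \<Longrightarrow>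
      \<psi> x t \<le> M * (W.weight x t * (exp (h t) * (1 - (norm x / R t)\<^sup>2)))"
    using W.upper_bound[OF h k(2)] by blast
  obtain \<epsilon> where \<epsilon>: "\<epsilon> > 0" "\<And>t x. t \<ge> T0 + 1 \<Longrightarrow> norm x \<le> R t \<Longrightarrow>
      \<epsilon> * (W.weight x t * (exp (- h t) * (1 - (norm x / R t)\<^sup>2))) \<le> \<psi> x t"
    using W.lower_bound[OF h k(2) pos] by blast
  define p' where "p' = \<alpha> * cs / (2 * D) - real DIM('a) / 2"
  obtain C where C: "\<And>(x::'a) t. t \<ge> T0 \<Longrightarrow> norm x \<le> R t \<Longrightarrow> R t - norm x \<le> Y \<Longrightarrow>
      exp (- C) * (t + 1) powr p' \<le> W.weight x t \<and> W.weight x t \<le> exp C * (t + 1) powr p'"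
    unfolding p'_def using weight_estimate[OF \<open>Y > 0\<close>, where 'a = 'a] by blast
  define \<beta>0 where "\<beta>0 = \<epsilon> * exp (- C) / (cs + E)"
  define b1 where "b1 = M * exp C * (4 / cs)"
  have \<beta>0: "\<beta>0 > 0" using \<epsilon>(1) cs_pos E by (simp add: \<beta>0_def)
  have est: "\<beta>0 * (R t - norm x) * (t + 1) powr p \<le> \<psi> x t \<and> \<psi> x t \<le> b1 * (R t - norm x) * (t + 1) powr p"
    if t: "t \<ge> T0 + 1" and x: "0 \<le> R t - norm x" "R t - norm x \<le> Y" for x :: 'a and t
  proof -
    have t': "t \<ge> T0" "t \<ge> 1" and x': "norm x \<le> R t" using t x T0 by auto
    define m where "m = 1 - (norm x / R t)\<^sup>2"
    define y where "y = R t - norm x"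
    have powr: "(t + 1) powr p' / (t + 1) = (t + 1) powr p"
    proof -
      have "p = p' - 1" by (simp add: p_def p'_def)
      then show ?thesis using t' by (simp add: powr_diff)
    qed
    have m: "y / ((cs + E) * (t + 1)) \<le> m" "m \<le> 4 / cs * y / (t + 1)"
      using boundary_distance[OF t'(1) x'] by (simp_all add: m_def y_def)
    have y: "0 \<le> y" using x by (simp add: y_def)
    have "0 \<le> y / ((cs + E) * (t + 1))" using y cs_pos E t' by simp
    then have m0: "0 \<le> m" using m(1) by linarith
    have "\<beta>0 * y * (t + 1) powr p = \<epsilon> * (exp (- C) * (t + 1) powr p' * (1 * (y / ((cs + E) * (t + 1)))))"
      unfolding powr[symmetric] by (simp add: \<beta>0_def)
    also have "\<dots> \<le> \<epsilon> * (W.weight x t * (exp (- h t) * m))"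
    proof (intro mult_left_mono mult_mono)
      show "exp (- C) * (t + 1) powr p' \<le> W.weight x t" using C[OF t'(1) x' x(2)] by simp
      show "1 \<le> exp (- h t)" using h_nonpos[of t] by simp
    qed (use m \<open>0 \<le> y / ((cs + E) * (t + 1))\<close> \<epsilon>(1) W.weight_pos[of x t] in auto)
    also have "\<dots> \<le> \<psi> x t" using \<epsilon>(2)[OF t x'] by (simp add: m_def)
    finally have lower: "\<beta>0 * y * (t + 1) powr p \<le> \<psi> x t" .
    have "\<psi> x t \<le> M * (W.weight x t * (exp (h t) * m))" using M(2)[OF t x'] by (simp add: m_def)
    also have "\<dots> \<le> M * (exp C * (t + 1) powr p' * (1 * (4 / cs * y / (t + 1))))"
    proof (intro mult_left_mono mult_mono)
      show "W.weight x t \<le> exp C * (t + 1) powr p'" using C[OF t'(1) x' x(2)] by simp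
      show "exp (h t) \<le> 1" using h_nonpos[of t] by simp
    qed (use m m0 M(1) in auto)
    also have "\<dots> = b1 * y * (t + 1) powr p"
      unfolding powr[symmetric] by (simp add: b1_def)
    finally show ?thesis using lower by (simp add: y_def)
  qed
  show ?thesis
  \<comment> \<open>The maximum secures the order of the two constants without comparing the two
    bounds at a point.\<close>
  proof (rule exI[of _ \<beta>0], rule exI[of _ "max \<beta>0 b1"], intro conjI allI impI)
    fix t and x :: 'a assume a: "T0 + 1 \<le> t" "0 \<le> R t - norm x \<and> R t - norm x \<le> Y"
    show "\<beta>0 * (R t - norm x) * (t + 1) powr p \<le> \<psi> x t" using est a by blast
    have "b1 * (R t - norm x) * (t + 1) powr p \<le> max \<beta>0 b1 * (R t - norm x) * (t + 1) powr p"
      by (intro mult_right_mono) (use a in auto)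
    then show "\<psi> x t \<le> max \<beta>0 b1 * (R t - norm x) * (t + 1) powr p" using est a by force
  qed (use \<beta>0 in auto)
qed

end

theorem theorem3p2:
  fixes D f0 cs \<alpha> :: real
    and R \<eta> \<eta>1 \<eta>2 \<eta>3 :: "real \<Rightarrow> real"
    and \<psi> :: "real ^ 'n \<Rightarrow> real \<Rightarrow> real"
  assumes "D > 0" and "f0 > 0" and "\<alpha> > 0"
    and "cs = 2 * sqrt (D * f0)"
    and "CARD('n) \<in> {1, 2, 3}"
    and "\<And>t. t \<ge> 0 \<Longrightarrow> R t = cs * t - \<alpha> * ln (t + 1) - \<eta> t"
    and "\<And>t. t \<ge> 0 \<Longrightarrow> R t > 0"
    and "\<And>t. t \<ge> 0 \<Longrightarrow> (\<eta> has_real_derivative \<eta>1 t) (at t within {0..})"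
    and "\<And>t. t \<ge> 0 \<Longrightarrow> (\<eta>1 has_real_derivative \<eta>2 t) (at t within {0..})"
    and "\<And>t. t \<ge> 0 \<Longrightarrow> (\<eta>2 has_real_derivative \<eta>3 t) (at t within {0..})"
    and "\<eta> \<in> O[at_top](\<lambda>_. 1)"
    and "\<eta>1 \<in> o[at_top](\<lambda>t. 1 / t)"
    and "\<eta>2 \<in> o[at_top](\<lambda>t. 1 / t ^ 2)"
    and "\<eta>3 \<in> o[at_top](\<lambda>t. 1 / t ^ 3)"
    and "moving_ball_solution D f0 R \<psi>"
    and "\<And>x t. t > 0 \<Longrightarrow> norm x \<le> R t \<Longrightarrow> \<psi> x t \<ge> 0"
    and "\<exists>t>0. \<exists>x. norm x \<le> R t \<and> \<psi> x t \<noteq> 0"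
  shows "\<forall>Y>0. \<exists>T>0. \<exists>\<beta>0 \<beta>1. 0 < \<beta>0 \<and> \<beta>0 \<le> \<beta>1 \<and>
           (\<forall>t\<ge>T. \<forall>x. 0 \<le> R t - norm x \<and> R t - norm x \<le> Y \<longrightarrow>
              \<beta>0 * (R t - norm x)
                  * (t + 1) powr (- 1 - real CARD('n) / 2 + \<alpha> * cs / (2 * D)) \<le> \<psi> x t \<and>
              \<psi> x t \<le> \<beta>1 * (R t - norm x)
                  * (t + 1) powr (- 1 - real CARD('n) / 2 + \<alpha> * cs / (2 * D)))"
proof -
  note sol = assms(15) and nonneg = assms(16)
  interpret critical_radius D f0 cs \<alpha> R \<eta> \<eta>1 \<eta>2 \<eta>3
    by unfold_locales (use assms in auto)
  obtain t0 x0 where nz: "t0 > 0" "norm x0 \<le> R t0" "\<psi> x0 t0 \<noteq> 0" using assms(17) by blast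
  \<comment> \<open>Positivity at the origin at all late times, not just at one, allows
    \<open>T0\<close> to lie beyond every other threshold as well.\<close>
  obtain t1 where t1: "\<And>t. t \<ge> t1 \<Longrightarrow> \<psi> 0 t > 0"
    using positivity_at_origin[OF \<open>D > 0\<close> _ sol nonneg _ R_cont nz] assms(2,7) by (metis less_imp_le)
  obtain T0 E where late: "T0 \<ge> 1" "T0 \<ge> t1" "E > 0"
      "\<And>t. t \<ge> T0 \<Longrightarrow> \<bar>\<eta> t\<bar> \<le> E" "\<And>t. t \<ge> T0 \<Longrightarrow> \<bar>\<eta>1 t\<bar> \<le> 1 / t"
      "\<And>t. t \<ge> T0 \<Longrightarrow> \<bar>\<eta>2 t\<bar> \<le> \<alpha> / 8 / t\<^sup>2" "\<And>t. t \<ge> T0 \<Longrightarrow> cs / 2 * (t + 1) \<le> R t"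
    using late_estimates[OF assms(11-13), of t1] by blast
  interpret late_critical_radius D f0 cs \<alpha> R \<eta> \<eta>1 \<eta>2 \<eta>3 T0 E
    by unfold_locales (use late in auto)
  show ?thesis
  \<comment> \<open>The same starting time serves every \<open>Y\<close>; only the two constants
    depend on it.\<close>
  proof (intro allI impI, rule exI[of _ "T0 + 1"], rule conjI)
    show "T0 + 1 > 0" using late(1) by simp
    fix Y :: real assume "Y > 0"
    from solution_estimate[OF sol nonneg t1[OF late(2)] this]
    show "\<exists>\<beta>0 \<beta>1. 0 < \<beta>0 \<and> \<beta>0 \<le> \<beta>1 \<and>
           (\<forall>t\<ge>T0 + 1. \<forall>x. 0 \<le> R t - norm x \<and> R t - norm x \<le> Y \<longrightarrow>
              \<beta>0 * (R t - norm x)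
                  * (t + 1) powr (- 1 - real CARD('n) / 2 + \<alpha> * cs / (2 * D)) \<le> \<psi> x t \<and>
              \<psi> x t \<le> \<beta>1 * (R t - norm x)
                  * (t + 1) powr (- 1 - real CARD('n) / 2 + \<alpha> * cs / (2 * D)))"
      by simp
  qed
qed

end
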